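(* For every constant $\rho>0$ there are constants $C,b>0$ (depending only on $\rho$) and a deterministic distributed algorithm in the CONGEST model that, for every $n$-vertex ($n\ge 4$) connected unweighted undirected graph $G=(V,E)$, constructs a $C(\log n)^{b}$-spanner of $G$ with at most $C\cdot n$ edges, in at most $C\cdot n^{\rho}$ rounds. (That is, a linear-size spanner with stretch $\mathrm{polylog}(n)$ in $O(n^\rho)$ deterministic time.)
   Context: All logarithms are to base $2$. A subgraph $G'=(V,H)$ of $G=(V,E)$ is an $\alpha$-spanner of $G$ ($\alpha\ge 1$) if $d_{G'}(u,v)\le \alpha\cdot d_G(u,v)$ for all $u,v\in V$, where $d_G,d_{G'}$ are the hop-distances in $G$ and $G'$. CONGEST model: each vertex of the input graph $G$ hosts a processor; vertices have distinct IDs in $\{1,2,\dots,O(n)\}$. Computation proceeds in synchronous rounds; in each round every vertex may send to each of its neighbors in $G$ a message containing $O(1)$ vertex IDs (i.e. $O(\log n)$ bits). Every vertex knows $n$ and $\rho$. The running time is the number of rounds of communication. Constructing a spanner means that at termination every vertex knows which of its incident edges belong to the spanner. *)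

theory Defs
  imports Complex_Main "HOL-Library.Extended_Real"
begin

section \<open>Simple graphs, hop distance and spanners\<close>

definition simple_graph :: "'v set \<Rightarrow> 'v set set \<Rightarrow> bool" where
  "simple_graph V E \<longleftrightarrow> finite V \<and> (\<forall>e\<in>E. e \<subseteq> V \<and> card e = 2)"

definition neighbors :: "'v set set \<Rightarrow> 'v \<Rightarrow> 'v set" where
  "neighbors E v = {u. {v, u} \<in> E}"

definition walks :: "'v set \<Rightarrow> 'v set set \<Rightarrow> 'v \<Rightarrow> 'v \<Rightarrow> 'v list set" where
  "walks V E u v =
    {p. p \<noteq> [] \<and> set p \<subseteq> V \<and> successively (\<lambda>x y. {x, y} \<in> E) p \<and> hd p = u \<and> last p = v}"

definition connected_graph :: "'v set \<Rightarrow> 'v set set \<Rightarrow> bool" where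
  "connected_graph V E \<longleftrightarrow> (\<forall>u\<in>V. \<forall>v\<in>V. walks V E u v \<noteq> {})"

text \<open>The distance is \<open>\<infinity>\<close> if there is no walk. A walk is given by its list of vertices, so its number
  of hops is one less than the length of the list.\<close>

definition hop_dist :: "'v set \<Rightarrow> 'v set set \<Rightarrow> 'v \<Rightarrow> 'v \<Rightarrow> enat" where
  "hop_dist V E u v = (INF p\<in>walks V E u v. enat (length p - 1))"

definition is_spanner :: "real \<Rightarrow> 'v set \<Rightarrow> 'v set set \<Rightarrow> 'v set set \<Rightarrow> bool" where
  "is_spanner \<alpha> V E H \<longleftrightarrow> 1 \<le> \<alpha> \<and> H \<subseteq> E \<and>
    (\<forall>u\<in>V. \<forall>v\<in>V. ereal_of_enat (hop_dist V H u v) \<le> ereal \<alpha> * ereal_of_enat (hop_dist V E u v))"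

section \<open>Deterministic algorithms in the CONGEST model\<close>

text \<open>Vertices are natural numbers and serve as their own IDs. A message is a list of numbers in the
  ID range, and the empty list means that nothing is sent. Local computation is unrestricted.

  A vertex starts in state \<open>init n v N\<close>, where \<open>n\<close> is the number of vertices, \<open>v\<close> its ID and \<open>N\<close>
  the set of IDs of its neighbors. In a round, a vertex in state \<open>s\<close> sends \<open>send s w\<close> to each
  neighbor \<open>w\<close>, and \<open>receive s m\<close> is its next state, where \<open>m u\<close> is the message received from
  neighbor \<open>u\<close>. As soon as \<open>result s = Some M\<close>, the vertex halts, having decided that precisely
  its edges to the vertices in \<open>M\<close> belong to the constructed subgraph.

  States hold finite information only, so taking \<open>nat\<close> for the type of states is no restriction.\<close>

record 's algorithm =
  init :: "nat \<Rightarrow> nat \<Rightarrow> nat set \<Rightarrow> 's"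
  send :: "'s \<Rightarrow> nat \<Rightarrow> nat list"
  receive :: "'s \<Rightarrow> (nat \<Rightarrow> nat list) \<Rightarrow> 's"
  result :: "'s \<Rightarrow> nat set option"

definition message :: "'s algorithm \<Rightarrow> 's \<Rightarrow> nat \<Rightarrow> nat list" where
  "message A s w = (if result A s = None then send A s w else [])"

text \<open>The state of each vertex after a given number of rounds:\<close>

primrec state :: "'s algorithm \<Rightarrow> nat set \<Rightarrow> nat set set \<Rightarrow> nat \<Rightarrow> nat \<Rightarrow> 's" where
  "state A V E 0 = (\<lambda>v. init A (card V) v (neighbors E v))"
| "state A V E (Suc t) = (\<lambda>v.
    if result A (state A V E t v) = None
    then receive A (state A V E t v)
      (\<lambda>u. if u \<in> neighbors E v then message A (state A V E t u) v else [])
    else state A V E t v)"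

text \<open>Every message consists of at most \<open>B\<close> numbers in the ID range \<open>{1..K * n}\<close>:\<close>

definition respects_bandwidth ::
    "nat \<Rightarrow> nat \<Rightarrow> 's algorithm \<Rightarrow> nat set \<Rightarrow> nat set set \<Rightarrow> bool" where
  "respects_bandwidth K B A V E \<longleftrightarrow>
    (\<forall>t. \<forall>u\<in>V. \<forall>w\<in>neighbors E u.
      length (message A (state A V E t u) w) \<le> B \<and>
      set (message A (state A V E t u) w) \<subseteq> {1..K * card V})"

text \<open>All vertices have halted after at most \<open>t\<close> rounds, and each knows its incident edges in \<open>H\<close>:\<close>

definition constructs_within ::
    "'s algorithm \<Rightarrow> nat set \<Rightarrow> nat set set \<Rightarrow> nat \<Rightarrow> nat set set \<Rightarrow> bool" where
  "constructs_within A V E t H \<longleftrightarrow> (\<forall>v\<in>V. result A (state A V E t v) = Some (neighbors H v))"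

end

(* Superclustering and interconnection, with clusters whose members all know the state of the cluster.

  In a phase with degree d, every cluster learns d of its neighboring clusters, or all of them if there
  are fewer. Among the clusters that have d neighbors, a set is selected whose members are at pairwise
  distance at least 3 in the cluster graph and which dominates the others within distance 2k. This is
  done digit by digit: the IDs have k digits in a base of order n^(1/k), and the clusters with digit x,
  for increasing x, remove those with a larger digit within distance 2. The selected clusters absorb
  everything within distance 2k, which adds one edge per absorbed cluster and multiplies the diameter
  by a constant. As their neighborhoods are disjoint, the number of clusters drops by a factor of d + 1.
  The other clusters have fewer than d neighbors; they keep an edge to each of them and retire.

  The degrees are 2^(2^i), each for 2k phases, up to the base. Then the number of edges added in the
  phases decreases geometrically, no cluster is left in the end, and the diameters are polylogarithmic
  because there are O(log log n) phases. The only communication within a phase is computing, in every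
  cluster, the maximum of the values at the neighbors of its vertices. *)
theory Submission
  imports Defs "HOL-Library.Countable_Set"
begin

section \<open>Local programs as algorithms\<close>

text \<open>Congestion shapes the construction: with O(1) IDs per message, an aggregation teaches a
  cluster only one new neighbor, so a phase of degree \<open>d\<close> needs \<open>d\<close>
  aggregations. This caps the degrees at about n^(1/k). The same number serves as the digit base,
  where it bounds the time of the selection; the selection asks only existence questions, and those
  survive aggregation by maxima.

  Squaring the degree matches the loss of clusters: two phases of degree \<open>d\<close> already
  divide their number by d^2, so the level of degree \<open>d\<close> starts with at most 4n/d^2
  clusters and adds only O(n/d) edges. The number 2k of repetitions is dictated by the last level:
  the square of its degree exceeds the base, so 2k repetitions divide by more than base^k, which
  exceeds n.

  Stretch is controlled edge by edge. An edge is settled when the first of its ends retires, by a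
  detour through at most two clusters; this is why bounding the diameters is enough.

  The exponent \<rho> is split into two parts of size 1/k, one for the base and one that swallows
  the squared polylogarithmic diameter bound.\<close>

type_synonym 'd instr =
  "(nat \<Rightarrow> nat set \<Rightarrow> 'd \<Rightarrow> nat \<Rightarrow> nat list) \<times> (nat \<Rightarrow> nat set \<Rightarrow> 'd \<Rightarrow> (nat \<Rightarrow> nat list) \<Rightarrow> 'd)"

text \<open>Clipping makes the bandwidth bound hold for every program, whatever it tries to send. As
  0 is not an ID, a message containing it is dropped, so silence stands for 0.\<close>

definition clip :: "nat \<Rightarrow> nat list \<Rightarrow> nat list" where
  "clip m l = (if length l \<le> 2 \<and> set l \<subseteq> {1..m} then l else [])"

definition exec :: "nat \<Rightarrow> nat set set \<Rightarrow> 'd instr \<Rightarrow> (nat \<Rightarrow> 'd) \<Rightarrow> nat \<Rightarrow> 'd" where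
  "exec m E i c = (\<lambda>v. snd i v (neighbors E v) (c v)
     (\<lambda>u. if u \<in> neighbors E v then clip m (fst i u (neighbors E u) (c u) v) else []))"

definition run :: "nat \<Rightarrow> nat set set \<Rightarrow> 'd instr list \<Rightarrow> (nat \<Rightarrow> 'd) \<Rightarrow> nat \<Rightarrow> 'd" where
  "run m E is c = fold (exec m E) is c"

lemma run_Nil [simp]: "run m E [] c = c"
  by (simp add: run_def)

lemma run_Cons: "run m E (i # is) c = run m E is (exec m E i c)"
  by (simp add: run_def)

lemma run_append: "run m E (is @ js) c = run m E js (run m E is c)"
  by (simp add: run_def)

text \<open>One algorithm must serve graphs of every size, so the encoding of its states ranges over
  infinitely many instances. Finite sets of numbers are countable, and each carries finitely many
  edge sets.\<close>

lemma countable_subgraphs: "countable {(V :: nat set, E). finite V \<and> (\<forall>e\<in>E. e \<subseteq> V)}"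
proof -
  have "{(V :: nat set, E). finite V \<and> (\<forall>e\<in>E. e \<subseteq> V)} \<subseteq> Sigma (Collect finite) (\<lambda>V. Pow (Pow V))"
    by auto
  moreover have "countable (Sigma (Collect finite :: nat set set) (\<lambda>V. Pow (Pow V)))"
    by (intro countable_SIGMA countable_Collect_finite countable_finite) auto
  ultimately show ?thesis by (rule countable_subset)
qed

text \<open>Only countably many local states are reachable over all graphs, which is why the local states
  of a program may be of an arbitrary type.\<close>

lemma compile:
  fixes prog :: "nat \<Rightarrow> 'd instr list" and ini :: "nat \<Rightarrow> nat set \<Rightarrow> 'd" and out :: "'d \<Rightarrow> nat set"
  shows "\<exists>A :: nat algorithm. \<forall>V E. finite V \<and> (\<forall>e\<in>E. e \<subseteq> V) \<longrightarrow>
    respects_bandwidth K 2 A V E \<and>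
    (\<forall>v. result A (state A V E (length (prog (card V))) v) =
      Some (out (run (K * card V) E (prog (card V)) (\<lambda>v. ini v (neighbors E v)) v)))"
proof -
  \<comment> \<open>\<open>send\<close> and \<open>receive\<close> see nothing but the state, so it
    has to contain n, the ID, the neighborhood and the round. The round is capped at the program
    length, so that the configuration stops changing exactly when the algorithm halts.\<close>
  define cfg where "cfg = (\<lambda>(V :: nat set, E, t :: nat, v :: nat).
    (card V, v, neighbors E v, min t (length (prog (card V))),
      run (K * card V) E (take t (prog (card V))) (\<lambda>v. ini v (neighbors E v)) v))"
  define S where "S = (\<lambda>((V, E), t, v). cfg (V, E, t, v)) `
    ({(V, E). finite V \<and> (\<forall>e\<in>E. e \<subseteq> V)} \<times> UNIV \<times> UNIV)"
  have "countable S"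
    unfolding S_def by (intro countable_image countable_SIGMA countable_subgraphs) auto
  define enc where "enc = to_nat_on S"
  define dec where "dec = from_nat_into S"
  have dec: "dec (enc s) = s" if "s \<in> S" for s
    unfolding dec_def enc_def using \<open>countable S\<close> that by simp
  have cfg_dec: "dec (enc (cfg (V, E, t, v))) = cfg (V, E, t, v)"
    if "finite V" "\<forall>e\<in>E. e \<subseteq> V" for V E t v
  proof (rule dec)
    have "((V, E), t, v) \<in> {(V, E). finite V \<and> (\<forall>e\<in>E. e \<subseteq> V)} \<times> UNIV \<times> UNIV"
      using that by simp
    then show "cfg (V, E, t, v) \<in> S"
      unfolding S_def by (rule rev_image_eqI) simp
  qed
  define A where "A = \<lparr>init = (\<lambda>n v N. enc (n, v, N, 0, ini v N)),
     send = (\<lambda>s w. case dec s of (n, v, N, t, d) \<Rightarrow> clip (K * n) (fst (prog n ! t) v N d w)),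
     receive = (\<lambda>s m. case dec s of (n, v, N, t, d) \<Rightarrow>
       enc (n, v, N, Suc t, snd (prog n ! t) v N d m)),
     result = (\<lambda>s. case dec s of (n, v, N, t, d) \<Rightarrow>
       if t < length (prog n) then None else Some (out d))\<rparr>"
  have "respects_bandwidth K 2 A V E \<and>
    (\<forall>v. result A (state A V E (length (prog (card V))) v) =
      Some (out (run (K * card V) E (prog (card V)) (\<lambda>v. ini v (neighbors E v)) v)))"
    if G: "finite V" "\<forall>e\<in>E. e \<subseteq> V" for V E
  proof -
    let ?L = "length (prog (card V))"
    have st: "state A V E t v = enc (cfg (V, E, t, v))" for t v
    proof (induction t arbitrary: v)
      case 0
      show ?case by (simp add: A_def cfg_def)
    next
      case (Suc t)
      show ?case
      proof (cases "t < ?L")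
        case True
        have res: "result A (enc (cfg (V, E, t, u))) = None" for u
          using True unfolding A_def by (simp add: cfg_dec[OF G]) (simp add: cfg_def)
        have msg: "message A (enc (cfg (V, E, t, u))) w =
          clip (K * card V) (fst (prog (card V) ! t) u (neighbors E u)
            (run (K * card V) E (take t (prog (card V))) (\<lambda>v. ini v (neighbors E v)) u) w)" for u w
          using res[of u] True unfolding message_def
          by (simp add: A_def cfg_dec[OF G]) (simp add: cfg_def)
        have rec: "receive A (enc (cfg (V, E, t, v))) f = enc (card V, v, neighbors E v, Suc t,
          snd (prog (card V) ! t) v (neighbors E v)
           (run (K * card V) E (take t (prog (card V))) (\<lambda>v. ini v (neighbors E v)) v) f)" for f
          using True by (simp add: A_def cfg_dec[OF G]) (simp add: cfg_def)
        have tk: "take (Suc t) (prog (card V)) = take t (prog (card V)) @ [prog (card V) ! t]"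
          using True by (simp add: take_Suc_conv_app_nth)
        show ?thesis
          using True
          by (simp add: Suc.IH res msg rec cong: if_cong)
             (simp add: cfg_def tk run_append run_Cons exec_def[abs_def] cong: if_cong)
      next
        case False
        have "result A (enc (cfg (V, E, t, v))) \<noteq> None"
          using False unfolding A_def by (simp add: cfg_dec[OF G]) (simp add: cfg_def)
        then have "state A V E (Suc t) v = enc (cfg (V, E, t, v))"
          by (auto simp: Suc.IH)
        moreover have "cfg (V, E, t, v) = cfg (V, E, Suc t, v)"
          using False by (simp add: cfg_def)
        ultimately show ?thesis by simp
      qed
    qed
    have "length (message A s w) \<le> 2 \<and> set (message A (enc (cfg (V, E, t, u))) w) \<subseteq> {1..K * card V}"
      for s t u w
      unfolding message_def A_def
      by (auto simp: cfg_dec[OF G] clip_def split: prod.splits) (auto simp: cfg_def split: if_splits)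
    then have "respects_bandwidth K 2 A V E"
      unfolding respects_bandwidth_def by (simp add: st)
    moreover have "result A (state A V E ?L v) =
      Some (out (run (K * card V) E (prog (card V)) (\<lambda>v. ini v (neighbors E v)) v))" for v
      unfolding st by (simp add: A_def cfg_dec[OF G]) (simp add: cfg_def)
    ultimately show ?thesis by blast
  qed
  then show ?thesis by blast
qed

section \<open>Aggregation within clusters\<close>

text \<open>Reachability with a budget serves three distances: within a cluster for flooding, in the
  cluster graph, and along chosen edges. Only upper bounds occur, and budgets add up along
  concatenated paths.\<close>

primrec near :: "('a \<Rightarrow> 'a \<Rightarrow> bool) \<Rightarrow> nat \<Rightarrow> 'a \<Rightarrow> 'a \<Rightarrow> bool" where
  "near R 0 u v \<longleftrightarrow> u = v"
| "near R (Suc r) u v \<longleftrightarrow> near R r u v \<or> (\<exists>w. R u w \<and> near R r w v)"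

lemma near_refl [simp]: "near R r u u"
  by (induction r) auto

lemma near_mono:
  assumes "near R r u v" "r \<le> s" "\<And>a b. R a b \<Longrightarrow> Q a b"
  shows "near Q s u v"
proof -
  have "near Q r u v"
    using assms(1,3) by (induction r arbitrary: u) auto
  with \<open>r \<le> s\<close> show ?thesis
    by (induction rule: dec_induct) auto
qed

lemma near_trans: "near R r u v \<Longrightarrow> near R s v w \<Longrightarrow> near R (r + s) u w"
proof (induction r arbitrary: u)
  case 0
  then show ?case by simp
next
  case (Suc r)
  then show ?case by auto
qed

lemma near_edge: "R u v \<Longrightarrow> near R (Suc 0) u v"
  by auto

lemma near_sym: "(\<And>a b. R a b \<Longrightarrow> R b a) \<Longrightarrow> near R r u v \<Longrightarrow> near R r v u"
proof (induction r arbitrary: u)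
  case 0
  then show ?case by simp
next
  case (Suc r)
  from Suc.prems(2) consider "near R r u v" | w where "R u w" "near R r w v" by auto
  then show ?case
  proof cases
    case 1
    then show ?thesis using Suc by auto
  next
    case 2
    then have "near R (r + Suc 0) v u"
      using Suc by (intro near_trans[of R r v w]) auto
    then show ?thesis by simp
  qed
qed

lemma near_cases:
  assumes "near R r u v" obtains "u = v" | w where "R u w"
  using assms by (induction r arbitrary: u) auto

text \<open>All members of a cluster hold the ID of the cluster, which is the ID of one of them, and agree on
  everything but \<open>chosen\<close> and \<open>pending\<close>, their incident edges in the spanner and the edges to be added
  in case the cluster retires. Vertices of retired clusters have cluster \<open>0\<close>, which is not an ID, and
  label \<open>0\<close> stands for an unlabelled cluster.\<close>

record vertex_state =
  cluster :: nat
  chosen :: "nat set"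
  seen :: "nat set"
  pending :: "nat set"
  alive :: bool
  label :: nat
  mark :: nat

text \<open>The registers of a gather operation hold the numbers heard from the neighbors, a target value, and
  the current maximum of a flooding.\<close>

type_synonym full_state = "vertex_state \<times> (nat \<Rightarrow> nat) \<times> nat \<times> nat"

text \<open>The cluster ID travels along with the value because a vertex does not know which
  neighbors share its cluster. This pair is why messages have length 2.\<close>

definition flood :: "full_state instr" where
  "flood = (\<lambda>v N (s, r, t, y) w. [cluster s, y],
     \<lambda>v N (s, r, t, y) m. (s, r, t, Max (insert y {m w ! 1 |w. w \<in> N \<and> m w \<noteq> [] \<and> hd (m w) = cluster s})))"

definition best :: "nat set \<Rightarrow> nat set \<Rightarrow> (nat \<Rightarrow> nat) \<Rightarrow> nat" where
  "best X N r = Max (insert 0 {r w |w. w \<in> N \<and> r w \<notin> X})"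

text \<open>The second flooding elects, among the members that locally attain the maximum, the one
  with the largest ID. It alone proposes an edge, so a call costs a cluster at most one
  edge.\<close>

definition gather :: "nat \<Rightarrow> (vertex_state \<Rightarrow> nat) \<Rightarrow> (vertex_state \<Rightarrow> nat set) \<Rightarrow>
    (vertex_state \<Rightarrow> nat \<Rightarrow> nat set \<Rightarrow> vertex_state) \<Rightarrow> full_state instr list" where
  "gather \<Delta> b X f =
    (\<lambda>v N (s, r, t, y) w. [b s],
     \<lambda>v N (s, r, t, y) m. let r = (\<lambda>w. if m w = [] then 0 else hd (m w))
       in (s, r, 0, if cluster s = 0 then 0 else best (X s) N r)) #
    replicate \<Delta> flood @
    (\<lambda>v N (s, r, t, y) w. [],
     \<lambda>v N (s, r, t, y) m.
       (s, r, y, if cluster s \<noteq> 0 \<and> y \<noteq> 0 \<and> best (X s) N r = y then v else 0)) #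
    replicate \<Delta> flood @
    [(\<lambda>v N (s, r, t, y) w. [],
      \<lambda>v N (s, r, t, y) m.
        (f s t (if t \<noteq> 0 \<and> y = v then {Max {w \<in> N. r w = t}} else {}), r, t, y))]"

lemma length_gather: "length (gather \<Delta> b X f) = 2 * \<Delta> + 3"
  by (simp add: gather_def)

definition same_cluster :: "nat set set \<Rightarrow> (nat \<Rightarrow> nat) \<Rightarrow> nat \<Rightarrow> nat \<Rightarrow> bool" where
  "same_cluster E \<kappa> u v \<longleftrightarrow> {u, v} \<in> E \<and> \<kappa> u \<noteq> 0 \<and> \<kappa> u = \<kappa> v"

text \<open>The specification of \<open>gather\<close>: in a cluster, \<open>T\<close> and \<open>e\<close> are the values with which every vertex calls
  its update function. The vertices of retired clusters do not take part.\<close>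

definition gathered :: "nat set set \<Rightarrow> (nat \<Rightarrow> nat) \<Rightarrow> (nat \<Rightarrow> nat) \<Rightarrow> (nat \<Rightarrow> nat set) \<Rightarrow>
    (nat \<Rightarrow> nat) \<Rightarrow> (nat \<Rightarrow> nat set) \<Rightarrow> bool" where
  "gathered E \<kappa> b X T e \<longleftrightarrow>
    (\<forall>v. \<kappa> v = 0 \<longrightarrow> T v = 0 \<and> e v = {}) \<and>
    (\<forall>v w. \<kappa> v = \<kappa> w \<longrightarrow> T v = T w) \<and>
    (\<forall>v. T v \<noteq> 0 \<longrightarrow> (\<exists>w u. \<kappa> w = \<kappa> v \<and> {w, u} \<in> E \<and> b u = T v \<and> b u \<notin> X w)) \<and>
    (\<forall>w u. \<kappa> w \<noteq> 0 \<and> {w, u} \<in> E \<and> b u \<notin> X w \<longrightarrow> b u \<le> T w) \<and>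
    (\<forall>v u. u \<in> e v \<longrightarrow> {v, u} \<in> E \<and> b u = T v \<and> T v \<noteq> 0) \<and>
    (\<forall>v. T v \<noteq> 0 \<longrightarrow> (\<exists>x. \<kappa> x = \<kappa> v \<and> card (e x) = 1 \<and> (\<forall>w. \<kappa> w = \<kappa> v \<and> w \<noteq> x \<longrightarrow> e w = {})))"

locale graph =
  fixes E :: "nat set set" and V :: "nat set" and m :: nat
  assumes simple: "simple_graph V E" and ids: "V \<subseteq> {1..m}"
begin

lemma finite_V: "finite V"
  using simple by (simp add: simple_graph_def)

lemma edgeD: "{u, v} \<in> E \<Longrightarrow> u \<in> V \<and> v \<in> V \<and> u \<noteq> v"
  using simple by (force simp: simple_graph_def)

lemma edge_sym: "{u, v} \<in> E \<longleftrightarrow> {v, u} \<in> E"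
  by (simp add: insert_commute)

lemma neighbors_iff [simp]: "u \<in> neighbors E v \<longleftrightarrow> {v, u} \<in> E"
  by (simp add: neighbors_def)

lemma finite_neighbors: "finite (neighbors E v)"
  by (rule finite_subset[OF _ finite_V]) (auto dest: edgeD)

text \<open>The maximum is described by a bound and its attainment. Once \<open>k\<close> reaches
  the diameter, these two facts determine the value and make it equal throughout the
  cluster.\<close>

lemma run_flood:
  assumes "\<And>v. cluster (s v) \<le> m" "\<And>v. y v \<le> m"
  shows "\<exists>y'. run m E (replicate k flood) (\<lambda>v. (s v, r v, t v, y v)) = (\<lambda>v. (s v, r v, t v, y' v)) \<and>
    (\<forall>v w. near (same_cluster E (cluster \<circ> s)) k v w \<longrightarrow> y w \<le> y' v) \<and>
    (\<forall>v. \<exists>w. near (same_cluster E (cluster \<circ> s)) k v w \<and> y' v = y w)"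
proof (induction k)
  case 0
  show ?case by (rule exI[of _ y]) simp
next
  case (Suc k)
  let ?R = "same_cluster E (cluster \<circ> s)"
  obtain y' where y': "run m E (replicate k flood) (\<lambda>v. (s v, r v, t v, y v)) = (\<lambda>v. (s v, r v, t v, y' v))"
    "\<And>v w. near ?R k v w \<Longrightarrow> y w \<le> y' v" "\<And>v. \<exists>w. near ?R k v w \<and> y' v = y w"
    using Suc.IH by blast
  have "y' v \<le> m" for v
    using y'(3)[of v] assms(2) by auto
  define A where "A v = {y' w |w. {v, w} \<in> E \<and> 0 < cluster (s w) \<and> 0 < y' w \<and> cluster (s w) = cluster (s v)}" for v
  define y'' where "y'' v = Max (insert (y' v) (A v))" for v
  have fin: "finite (A v)" for v
  proof -
    have "A v \<subseteq> y' ` V" by (auto simp: A_def dest: edgeD)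
    then show ?thesis using finite_V finite_surj by blast
  qed
  define heard where "heard v = (\<lambda>w. if w \<in> neighbors E v then clip m [cluster (s w), y' w] else [])" for v
  have "{heard v w ! 1 |w. w \<in> neighbors E v \<and> heard v w \<noteq> [] \<and> hd (heard v w) = cluster (s v)} = A v" for v
    unfolding A_def heard_def using assms(1) \<open>\<And>v. y' v \<le> m\<close>
    by (intro Collect_cong ex_cong1) (auto simp: clip_def Suc_le_eq)
  then have "exec m E flood (\<lambda>v. (s v, r v, t v, y' v)) = (\<lambda>v. (s v, r v, t v, y'' v))"
    unfolding y''_def exec_def flood_def fst_conv snd_conv prod.case heard_def by simp
  then have "run m E (replicate (Suc k) flood) (\<lambda>v. (s v, r v, t v, y v)) = (\<lambda>v. (s v, r v, t v, y'' v))"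
    unfolding replicate_Suc replicate_append_same[symmetric] run_append y'(1) by (simp add: run_Cons)
  moreover have "y w \<le> y'' v" if nr: "near ?R (Suc k) v w" for v w
  proof -
    consider "near ?R k v w" | u where "?R v u" "near ?R k u w"
      using nr by auto
    then show ?thesis
    proof cases
      case 1
      then have "y w \<le> y' v" by (rule y')
      also have "y' v \<le> y'' v" unfolding y''_def using fin by simp
      finally show ?thesis .
    next
      case 2
      then have "y w \<le> y' u" by (intro y')
      also have "y' u \<le> y'' v"
      \<comment> \<open>A value 0 is never received, since \<open>clip\<close> drops the message,
        but then the bound is trivial.\<close>
      proof (cases "y' u = 0")
        case False
        then have "y' u \<in> A v"
          using 2(1) unfolding A_def same_cluster_def by auto
        then show ?thesis unfolding y''_def using fin by simp
      qed simp
      finally show ?thesis .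
    qed
  qed
  moreover have "\<exists>w. near ?R (Suc k) v w \<and> y'' v = y w" for v
  proof -
    have "y'' v \<in> insert (y' v) (A v)"
      unfolding y''_def using fin by (intro Max_in) auto
    then have "y'' v = y' v \<or> (\<exists>u. ?R v u \<and> y'' v = y' u)"
      unfolding A_def same_cluster_def by auto
    then consider "y'' v = y' v" | u where "?R v u" "y'' v = y' u"
      by blast
    then show ?thesis
      using y'(3) by cases (metis near.simps(2))+
  qed
  ultimately show ?case by blast
qed

lemma run_gather:
  fixes c :: "nat \<Rightarrow> full_state"
  defines "s \<equiv> fst \<circ> c"
  defines "\<kappa> \<equiv> cluster \<circ> s"
  assumes \<kappa>: "\<And>v. \<kappa> v \<noteq> 0 \<Longrightarrow> v \<in> V \<and> \<kappa> v \<le> m"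
    and b: "\<And>v. b (s v) \<le> m"
    and diam: "\<And>u v. \<kappa> u \<noteq> 0 \<Longrightarrow> \<kappa> u = \<kappa> v \<Longrightarrow> near (same_cluster E \<kappa>) \<Delta> u v"
  shows "\<exists>T e. gathered E \<kappa> (b \<circ> s) (X \<circ> s) T e \<and>
    fst \<circ> run m E (gather \<Delta> b X f) c = (\<lambda>v. f (s v) (T v) (e v))"
proof -
  have \<kappa>_le: "cluster (s v) \<le> m" for v
    using \<kappa>[of v] by (cases "\<kappa> v = 0") (auto simp: \<kappa>_def)
  define r where "r v w = (if {v, w} \<in> E then b (s w) else 0)" for v w
  define y0 where "y0 v = (if \<kappa> v = 0 then 0 else best (X (s v)) (neighbors E v) (r v))" for v
  have r_eq: "(\<lambda>w. if (if {v, w} \<in> E then clip m [b (s w)] else []) = [] then 0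
      else hd (if {v, w} \<in> E then clip m [b (s w)] else [])) = r v" for v
    using b by (intro ext) (auto simp: r_def clip_def)
  obtain r' t' y' where c: "c = (\<lambda>v. (s v, r' v, t' v, y' v))"
  proof
    show "c = (\<lambda>v. (s v, (fst \<circ> snd \<circ> c) v, (fst \<circ> snd \<circ> snd \<circ> c) v, (snd \<circ> snd \<circ> snd \<circ> c) v))"
      by (simp add: s_def)
  qed
  have e0: "exec m E (\<lambda>v N (s, r, t, y) w. [b s],
     \<lambda>v N (s, r, t, y) m. let r = (\<lambda>w. if m w = [] then 0 else hd (m w))
       in (s, r, 0, if cluster s = 0 then 0 else best (X s) N r)) c = (\<lambda>v. (s v, r v, 0, y0 v))"
    unfolding exec_def c fst_conv snd_conv prod.case Let_def neighbors_iff r_eq y0_def \<kappa>_def comp_def ..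
  have fin: "finite {r v w |w. w \<in> neighbors E v \<and> r v w \<notin> Y}" for v Y
  proof -
    have "{r v w |w. w \<in> neighbors E v \<and> r v w \<notin> Y} \<subseteq> r v ` neighbors E v" by auto
    then show ?thesis using finite_neighbors finite_surj by blast
  qed
  have y0_ge: "b (s u) \<le> y0 v" if "\<kappa> v \<noteq> 0" "{v, u} \<in> E" "b (s u) \<notin> X (s v)" for u v
  proof -
    have "r v u \<le> best (X (s v)) (neighbors E v) (r v)"
      unfolding best_def
    proof (intro Max_ge)
      have "r v u = b (s u)" using that by (simp add: r_def)
      then show "r v u \<in> insert 0 {r v w |w. w \<in> neighbors E v \<and> r v w \<notin> X (s v)}"
        using that by force
    qed (use fin in simp)
    then show ?thesis using that by (simp add: y0_def r_def)
  qed
  have y0_in: "\<exists>u. {v, u} \<in> E \<and> b (s u) = y0 v \<and> b (s u) \<notin> X (s v)" if nz: "y0 v \<noteq> 0" for v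
  proof -
    have "best (X (s v)) (neighbors E v) (r v) \<in>
      insert 0 {r v w |w. w \<in> neighbors E v \<and> r v w \<notin> X (s v)}"
      unfolding best_def using fin by (intro Max_in) auto
    moreover have "best (X (s v)) (neighbors E v) (r v) = y0 v"
      using nz by (simp add: y0_def split: if_splits)
    ultimately obtain u where "{v, u} \<in> E" "r v u = y0 v" "r v u \<notin> X (s v)"
      using nz by auto
    then show ?thesis by (auto simp: r_def)
  qed
  have y0_le: "y0 v \<le> m" for v
  proof (cases "y0 v = 0")
    case False
    then obtain u where "b (s u) = y0 v" using y0_in by blast
    then show ?thesis using b[of u] by simp
  qed simp
  let ?R = "same_cluster E \<kappa>"
  have near_\<kappa>: "\<kappa> u = \<kappa> v" if "near ?R k u v" for k u v
    using that
  proof (induction k arbitrary: u)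
    case 0
    then have "u = v" by (simp only: near.simps)
    then show ?case by (rule arg_cong)
  next
    case (Suc k)
    from Suc.prems consider "near ?R k u v" | w where "?R u w" "near ?R k w v"
      unfolding near.simps by blast
    then show ?case
    proof cases
      case 1
      then show ?thesis by (rule Suc.IH)
    next
      case 2
      then have "\<kappa> u = \<kappa> w" by (simp only: same_cluster_def)
      also have "\<kappa> w = \<kappa> v" using 2(2) by (rule Suc.IH)
      finally show ?thesis .
    qed
  qed
  have near_0: "u = v" if "near ?R k u v" "\<kappa> u = 0" for k u v
    using that(1)
  proof (cases rule: near_cases)
    case (2 w)
    then show ?thesis using that(2) by (simp add: same_cluster_def)
  qed
  obtain T where T: "run m E (replicate \<Delta> flood) (\<lambda>v. (s v, r v, 0, y0 v)) = (\<lambda>v. (s v, r v, 0, T v))"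
    "\<And>v w. near ?R \<Delta> v w \<Longrightarrow> y0 w \<le> T v" "\<And>v. \<exists>w. near ?R \<Delta> v w \<and> T v = y0 w"
    using run_flood[of s y0 \<Delta> r "\<lambda>_. 0", OF \<kappa>_le y0_le] unfolding \<kappa>_def by blast
  define z0 where "z0 v = (if \<kappa> v \<noteq> 0 \<and> T v \<noteq> 0 \<and> y0 v = T v then v else 0)" for v
  have e1: "exec m E (\<lambda>v N (s, r, t, y) w. [],
     \<lambda>v N (s, r, t, y) m.
       (s, r, y, if cluster s \<noteq> 0 \<and> y \<noteq> 0 \<and> best (X s) N r = y then v else 0))
     (\<lambda>v. (s v, r v, 0, T v)) = (\<lambda>v. (s v, r v, T v, z0 v))"
    unfolding exec_def fst_conv snd_conv prod.case
    by (intro ext) (auto simp: z0_def y0_def \<kappa>_def)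
  have z0_le: "z0 v \<le> m" for v
    using \<kappa>[of v] ids by (auto simp: z0_def)
  obtain z where z: "run m E (replicate \<Delta> flood) (\<lambda>v. (s v, r v, T v, z0 v)) = (\<lambda>v. (s v, r v, T v, z v))"
    "\<And>v w. near ?R \<Delta> v w \<Longrightarrow> z0 w \<le> z v" "\<And>v. \<exists>w. near ?R \<Delta> v w \<and> z v = z0 w"
    using run_flood[of s z0 \<Delta> r T, OF \<kappa>_le z0_le] unfolding \<kappa>_def by blast
  define e where "e v = (if T v \<noteq> 0 \<and> z v = v then {Max {w \<in> neighbors E v. r v w = T v}} else {})" for v
  have e2: "exec m E (\<lambda>v N (s, r, t, y) w. [],
      \<lambda>v N (s, r, t, y) m.
        (f s t (if t \<noteq> 0 \<and> y = v then {Max {w \<in> N. r w = t}} else {}), r, t, y))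
     (\<lambda>v. (s v, r v, T v, z v)) = (\<lambda>v. (f (s v) (T v) (e v), r v, T v, z v))"
    unfolding exec_def e_def fst_conv snd_conv prod.case ..
  have run: "fst \<circ> run m E (gather \<Delta> b X f) c = (\<lambda>v. f (s v) (T v) (e v))"
    unfolding gather_def run_Cons run_append e0 T(1) e1 z(1) e2 run_Nil
    by (simp add: comp_def)
  have T0: "T v = 0" if "\<kappa> v = 0" for v
  proof -
    obtain w where w: "near ?R \<Delta> v w" "T v = y0 w" using T(3) by blast
    have "v = w" using near_0[OF w(1) that] .
    then show ?thesis using w(2) that by (simp add: y0_def)
  qed
  \<comment> \<open>Both floodings satisfy the same two conditions, so agreement within a cluster is
    shown once for arbitrary \<open>g0\<close> and \<open>g\<close>.\<close>
  have max_eq: "g u = g v"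
    if g: "\<And>v w. near ?R \<Delta> v w \<Longrightarrow> g0 w \<le> g v" "\<And>v. \<exists>w. near ?R \<Delta> v w \<and> g v = g0 w"
      and uv: "\<kappa> u \<noteq> 0" "\<kappa> u = \<kappa> v" for g g0 :: "nat \<Rightarrow> nat" and u v
  proof -
    have le: "g u \<le> g v" if h: "\<kappa> u \<noteq> 0" "\<kappa> u = \<kappa> v" for u v
    proof -
      obtain w where w: "near ?R \<Delta> u w" "g u = g0 w" using g(2) by blast
      have "\<kappa> v \<noteq> 0" "\<kappa> v = \<kappa> w" using near_\<kappa>[OF w(1)] h by simp_all
      then have "near ?R \<Delta> v w" by (rule diam)
      then show ?thesis unfolding w(2) by (rule g(1))
    qed
    have "\<kappa> v \<noteq> 0" "\<kappa> v = \<kappa> u" using uv by simp_all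
    from le[OF this] le[OF uv] show ?thesis by simp
  qed
  have T_eq: "T u = T v" if "\<kappa> u = \<kappa> v" for u v
  proof (cases "\<kappa> u = 0")
    case True
    then show ?thesis using T0[of u] T0[of v] that by simp
  next
    case False
    show ?thesis by (rule max_eq[of y0 T, OF T(2,3) False that])
  qed
  have pos: "v \<noteq> 0" if "\<kappa> v \<noteq> 0" for v
    using \<kappa>[OF that] ids by auto
  \<comment> \<open>\<open>z0\<close> takes only the value 0 and the own ID of a vertex. So a
    nonzero \<open>z v\<close> equal to \<open>v\<close> can only originate at \<open>v\<close>,
    which was therefore a candidate.\<close>
  have zD: "\<kappa> v \<noteq> 0 \<and> y0 v = T v" if "T v \<noteq> 0" "z v = v" for v
  proof -
    have "\<kappa> v \<noteq> 0" using T0[of v] that by blast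
    then have "z v \<noteq> 0" using pos that by simp
    obtain w where "z v = z0 w" using z(3) by blast
    with \<open>z v \<noteq> 0\<close> that(2) have "z0 v \<noteq> 0" by (auto simp: z0_def split: if_splits)
    then show ?thesis by (simp add: z0_def split: if_splits)
  qed
  have e_in: "{v, u} \<in> E \<and> b (s u) = T v \<and> T v \<noteq> 0" if "u \<in> e v" for u v
  proof -
    have tz: "T v \<noteq> 0" "z v = v" and u: "u = Max {w \<in> neighbors E v. r v w = T v}"
      using that by (auto simp: e_def split: if_splits)
    obtain w where "{v, w} \<in> E" "b (s w) = T v"
      using y0_in[of v] zD[OF tz] tz by auto
    then have "{w \<in> neighbors E v. r v w = T v} \<noteq> {}"
      by (auto simp: r_def)
    then have "u \<in> {w \<in> neighbors E v. r v w = T v}"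
      unfolding u
      by (intro Max_in finite_subset[OF _ finite_neighbors[of v]]) blast+
    then show ?thesis using tz by (auto simp: r_def)
  qed
  have unique: "\<exists>x. \<kappa> x = \<kappa> v \<and> card (e x) = 1 \<and> (\<forall>w. \<kappa> w = \<kappa> v \<and> w \<noteq> x \<longrightarrow> e w = {})"
    if "T v \<noteq> 0" for v
  proof -
    have "\<kappa> v \<noteq> 0" using T0[of v] that by blast
    obtain w where w: "near ?R \<Delta> v w" "T v = y0 w" using T(3) by blast
    have "\<kappa> w = \<kappa> v" using near_\<kappa>[OF w(1)] by simp
    then have "z0 w = w"
      using w(2) that \<open>\<kappa> v \<noteq> 0\<close> T_eq[of w v] by (simp add: z0_def)
    then have "z v \<noteq> 0"
      using z(2)[OF w(1)] pos[of w] \<open>\<kappa> w = \<kappa> v\<close> \<open>\<kappa> v \<noteq> 0\<close> by simp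
    obtain x where x: "near ?R \<Delta> v x" "z v = z0 x" using z(3) by blast
    have "z v = x" using x \<open>z v \<noteq> 0\<close> by (auto simp: z0_def split: if_splits)
    have eq: "z u = x" if "\<kappa> u = \<kappa> v" for u
      using max_eq[of z0 z u v, OF z(2,3)] that \<open>\<kappa> v \<noteq> 0\<close> \<open>z v = x\<close> by simp
    have "\<kappa> x = \<kappa> v" using near_\<kappa>[OF x(1)] by simp
    moreover from this have "card (e x) = 1"
      using eq[of x] T_eq[of x v] that by (simp add: e_def)
    moreover have "e w = {}" if "\<kappa> w = \<kappa> v" "w \<noteq> x" for w
      using eq[of w] that by (simp add: e_def)
    ultimately show ?thesis by blast
  qed
  have "gathered E \<kappa> (b \<circ> s) (X \<circ> s) T e"
    unfolding gathered_def
  proof (intro conjI allI impI; (elim conjE)?)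
    fix v assume "\<kappa> v = 0"
    then show "T v = 0" by (rule T0)
    with \<open>\<kappa> v = 0\<close> show "e v = {}" by (simp add: e_def)
  next
    fix v assume "T v \<noteq> 0"
    obtain w where "near ?R \<Delta> v w" "T v = y0 w" using T(3) by blast
    then show "\<exists>w u. \<kappa> w = \<kappa> v \<and> {w, u} \<in> E \<and> (b \<circ> s) u = T v \<and> (b \<circ> s) u \<notin> (X \<circ> s) w"
      using y0_in[of w] \<open>T v \<noteq> 0\<close> near_\<kappa> by (metis comp_apply)
  next
    fix w u assume "\<kappa> w \<noteq> 0" "{w, u} \<in> E" "(b \<circ> s) u \<notin> (X \<circ> s) w"
    then have "(b \<circ> s) u \<le> y0 w" using y0_ge by simp
    also have "y0 w \<le> T w" by (intro T) simp
    finally show "(b \<circ> s) u \<le> T w" .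
  next
    fix v w assume "\<kappa> v = \<kappa> w"
    then show "T v = T w" by (rule T_eq)
  next
    fix v u assume "u \<in> e v"
    from e_in[OF this] show "{v, u} \<in> E" "(b \<circ> s) u = T v" "T v \<noteq> 0" by simp_all
  next
    fix v assume "T v \<noteq> 0"
    then show "\<exists>x. \<kappa> x = \<kappa> v \<and> card (e x) = 1 \<and> (\<forall>w. \<kappa> w = \<kappa> v \<and> w \<noteq> x \<longrightarrow> e w = {})"
      by (rule unique)
  qed
  with run show ?thesis by blast
qed

end

section \<open>Ruling sets\<close>

definition digit :: "nat \<Rightarrow> nat \<Rightarrow> nat \<Rightarrow> nat" where
  "digit \<beta> j a = a div \<beta> ^ j mod \<beta>"

lemma digits_eq:
  assumes "\<And>j. j < k \<Longrightarrow> digit \<beta> j a = digit \<beta> j b" "a < \<beta> ^ k" "b < \<beta> ^ k"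
  shows "a = b"
proof -
  have "a mod \<beta> ^ k = b mod \<beta> ^ k"
    using assms(1)
  proof (induction k)
    case (Suc k)
    then show ?case
      by (simp add: mod_mult2_eq digit_def mult.commute[of \<beta>])
  qed simp
  then show ?thesis using assms by simp
qed

definition kill :: "(nat \<Rightarrow> nat \<Rightarrow> bool) \<Rightarrow> nat \<Rightarrow> nat \<Rightarrow> nat \<Rightarrow> nat set \<Rightarrow> nat set" where
  "kill Q \<beta> j x A = {a \<in> A. \<not> (x < digit \<beta> j a \<and> (\<exists>b\<in>A. digit \<beta> j b = x \<and> Q a b))}"

definition sweep :: "(nat \<Rightarrow> nat \<Rightarrow> bool) \<Rightarrow> nat \<Rightarrow> nat \<Rightarrow> nat \<Rightarrow> nat set \<Rightarrow> nat set" where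
  "sweep Q \<beta> x j A = fold (kill Q \<beta> j) [0..<x] A"

definition ruling :: "(nat \<Rightarrow> nat \<Rightarrow> bool) \<Rightarrow> nat \<Rightarrow> nat \<Rightarrow> nat set \<Rightarrow> nat set" where
  "ruling Q \<beta> k A = fold (sweep Q \<beta> \<beta>) [0..<k] A"

lemma sweep_0 [simp]: "sweep Q \<beta> 0 j A = A"
  by (simp add: sweep_def)

lemma sweep_Suc: "sweep Q \<beta> (Suc x) j A = kill Q \<beta> j x (sweep Q \<beta> x j A)"
  by (simp add: sweep_def)

lemma ruling_0 [simp]: "ruling Q \<beta> 0 A = A"
  by (simp add: ruling_def)

lemma ruling_Suc: "ruling Q \<beta> (Suc k) A = sweep Q \<beta> \<beta> k (ruling Q \<beta> k A)"
  by (simp add: ruling_def)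

text \<open>A round \<open>x\<close> removes only digits above \<open>x\<close>, so a killer
  survives its own round and all later ones. Recording that the dominator has a digit below
  \<open>x\<close> is what carries domination through the induction with a single step of
  \<open>Q\<close>.\<close>

lemma sweep_inv:
  "sweep Q \<beta> x j A \<subseteq> A \<and>
   (\<forall>a\<in>sweep Q \<beta> x j A. \<forall>b\<in>sweep Q \<beta> x j A. Q a b \<and> digit \<beta> j b < x \<longrightarrow> digit \<beta> j a \<le> digit \<beta> j b) \<and>
   (\<forall>a\<in>A. a \<in> sweep Q \<beta> x j A \<or> (\<exists>b\<in>sweep Q \<beta> x j A. digit \<beta> j b < x \<and> Q a b))"
proof (induction x)
  case (Suc x)
  let ?B = "sweep Q \<beta> x j A" and ?B' = "sweep Q \<beta> (Suc x) j A"
  have sub: "?B' \<subseteq> ?B" by (auto simp: sweep_Suc kill_def)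
  have keep: "b \<in> ?B'" if "b \<in> ?B" "digit \<beta> j b \<le> x" for b
    using that by (auto simp: sweep_Suc kill_def)
  have "digit \<beta> j a \<le> digit \<beta> j b" if "a \<in> ?B'" "b \<in> ?B'" "Q a b" "digit \<beta> j b < Suc x" for a b
  proof (cases "digit \<beta> j b = x")
    case True
    then have "\<not> x < digit \<beta> j a"
      using that sub by (auto simp: sweep_Suc kill_def)
    with True show ?thesis by simp
  next
    case False
    then have "digit \<beta> j b < x" using that by simp
    moreover have "a \<in> ?B" "b \<in> ?B" using that sub by auto
    ultimately show ?thesis using Suc.IH \<open>Q a b\<close> by blast
  qed
  moreover have "a \<in> ?B' \<or> (\<exists>b\<in>?B'. digit \<beta> j b < Suc x \<and> Q a b)" if "a \<in> A" for a
  proof -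
    have "a \<in> ?B \<or> (\<exists>b\<in>?B. digit \<beta> j b < x \<and> Q a b)"
      using Suc.IH that by blast
    then consider "a \<in> ?B'" | "a \<in> ?B" "a \<notin> ?B'" | b where "b \<in> ?B" "digit \<beta> j b < x" "Q a b"
      by blast
    then show ?thesis
    proof cases
      case 2
      then obtain b where b: "b \<in> ?B" "digit \<beta> j b = x" "Q a b"
        unfolding sweep_Suc kill_def by blast
      then have "b \<in> ?B'" "digit \<beta> j b < Suc x" by (simp_all add: keep)
      then show ?thesis using b(3) by blast
    next
      case 3
      then have "b \<in> ?B'" "digit \<beta> j b < Suc x" by (simp_all add: keep)
      then show ?thesis using 3(3) by blast
    qed simp
  qed
  moreover have "?B' \<subseteq> A" using Suc.IH sub by (meson subset_trans)
  ultimately show ?case by (intro conjI ballI impI) (simp_all only:)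
qed simp

lemma ruling_subset: "ruling Q \<beta> k A \<subseteq> A"
proof (induction k)
  case (Suc k)
  then show ?case using sweep_inv[of Q \<beta> \<beta> k "ruling Q \<beta> k A"] by (auto simp: ruling_Suc)
qed simp

text \<open>If two related survivors differed in some digit, the sweep for that digit would have
  removed the one with the larger digit. Symmetry of \<open>Q\<close> turns the one-sided inequality
  of \<open>sweep_inv\<close> into equality.\<close>

lemma ruling_independent:
  assumes "0 < \<beta>" "\<And>a b. Q a b \<Longrightarrow> Q b a"
    and "a \<in> ruling Q \<beta> k A" "b \<in> ruling Q \<beta> k A" "Q a b" "a < \<beta> ^ k" "b < \<beta> ^ k"
  shows "a = b"
proof -
  have "\<forall>j<k. digit \<beta> j a = digit \<beta> j b"
    using assms(3,4)
  proof (induction k)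
    case (Suc k)
    let ?R = "ruling Q \<beta> k A"
    have ab: "a \<in> sweep Q \<beta> \<beta> k ?R" "b \<in> sweep Q \<beta> \<beta> k ?R"
      using Suc.prems by (simp_all add: ruling_Suc)
    have "digit \<beta> k c < \<beta>" for c using assms(1) by (simp add: digit_def)
    then have "digit \<beta> k a = digit \<beta> k b"
      using sweep_inv[of Q \<beta> \<beta> k ?R] ab assms(2,5) by (meson le_antisym)
    moreover have "a \<in> ?R" "b \<in> ?R"
      using sweep_inv[of Q \<beta> \<beta> k ?R] ab by auto
    ultimately show ?case using Suc.IH less_Suc_eq by auto
  qed simp
  then show ?thesis using digits_eq assms by blast
qed

text \<open>Each sweep moves the dominator by at most one step of \<open>Q\<close>, so
  \<open>k\<close> digits cost \<open>k\<close> steps.\<close>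

lemma ruling_dominates:
  assumes "a \<in> A"
  shows "\<exists>b\<in>ruling Q \<beta> k A. near Q k a b"
proof (induction k)
  case (Suc k)
  then obtain b where b: "b \<in> ruling Q \<beta> k A" "near Q k a b" by blast
  obtain c where "c \<in> ruling Q \<beta> (Suc k) A" "b = c \<or> Q b c"
    using sweep_inv[of Q \<beta> \<beta> k "ruling Q \<beta> k A"] b(1) by (force simp: ruling_Suc)
  moreover from this have "near Q (Suc 0) b c"
    using near_edge[of Q b c] by fastforce
  ultimately show ?case using near_trans[OF b(2), of "Suc 0" c] by auto
qed (use assms in auto)

text \<open>With \<open>s = 2\<close> this turns \<open>k\<close> steps of the relation "within
  distance 2" into distance 2k in the cluster graph.\<close>

lemma near_near:
  assumes "near (near R s) k u v"
  shows "near R (k * s) u v"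
  using assms
proof (induction k arbitrary: u)
  case (Suc k)
  then consider "near (near R s) k u v" | w where "near R s u w" "near (near R s) k w v"
    by auto
  then show ?case
  proof cases
    case 1
    from near_mono[OF Suc.IH[OF 1]] show ?thesis by simp
  next
    case 2
    from near_trans[OF 2(1) Suc.IH[OF 2(2)]] show ?thesis by simp
  qed
qed simp

lemma near_2: "near R 2 u v \<longleftrightarrow> u = v \<or> R u v \<or> (\<exists>w. R u w \<and> R w v)"
  by (auto simp: numeral_2_eq_2)

section \<open>A phase of superclustering\<close>

text \<open>A purely local change is run as a gather of zeros. This wastes rounds, but every step of
  a phase then has the same form.\<close>

definition update :: "nat \<Rightarrow> (vertex_state \<Rightarrow> vertex_state) \<Rightarrow> full_state instr list" where
  "update \<Delta> f = gather \<Delta> (\<lambda>_. 0) (\<lambda>_. {}) (\<lambda>s _ _. f s)"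

text \<open>A call finds the largest neighboring cluster ID not seen before. The edge to it is only
  put aside, because whether the cluster retires is decided later in the phase.\<close>

definition explore :: "nat \<Rightarrow> full_state instr list" where
  "explore \<Delta> = gather \<Delta> cluster (\<lambda>s. insert (cluster s) (seen s))
     (\<lambda>s t e. if t = 0 then s else s\<lparr>seen := insert t (seen s), pending := pending s \<union> e\<rparr>)"

definition selected :: "nat \<Rightarrow> nat \<Rightarrow> nat \<Rightarrow> vertex_state \<Rightarrow> bool" where
  "selected \<beta> j x s \<longleftrightarrow> alive s \<and> digit \<beta> j (cluster s) = x"

text \<open>Two gathers reach distance 2 in the cluster graph. Only whether a value is nonzero
  matters, so keeping just the maximum loses nothing.\<close>

definition kill_round :: "nat \<Rightarrow> nat \<Rightarrow> nat \<Rightarrow> nat \<Rightarrow> full_state instr list" where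
  "kill_round \<Delta> \<beta> j x =
     gather \<Delta> (\<lambda>s. if selected \<beta> j x s then cluster s else 0) (\<lambda>_. {})
       (\<lambda>s t _. s\<lparr>mark := if selected \<beta> j x s then cluster s else t\<rparr>) @
     gather \<Delta> mark (\<lambda>_. {})
       (\<lambda>s t _. if x < digit \<beta> j (cluster s) \<and> (mark s \<noteq> 0 \<or> t \<noteq> 0) then s\<lparr>alive := False\<rparr> else s)"

definition spread :: "nat \<Rightarrow> full_state instr list" where
  "spread \<Delta> = gather \<Delta> label (\<lambda>_. {})
     (\<lambda>s t e. if label s = 0 \<and> t \<noteq> 0 then s\<lparr>label := t, chosen := chosen s \<union> e\<rparr> else s)"

definition finish :: "nat \<Rightarrow> full_state instr list" where
  "finish \<Delta> = update \<Delta> (\<lambda>s. s\<lparr>cluster := label s, seen := {}, pending := {},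
     chosen := if label s = 0 then chosen s \<union> pending s else chosen s\<rparr>)"

definition loop :: "nat \<Rightarrow> (nat \<Rightarrow> 'd instr list) \<Rightarrow> 'd instr list" where
  "loop k p = concat (map p [0..<k])"

definition phase :: "nat \<Rightarrow> nat \<Rightarrow> nat \<Rightarrow> nat \<Rightarrow> full_state instr list" where
  "phase \<Delta> \<beta> k d =
     loop d (\<lambda>_. explore \<Delta>) @
     update \<Delta> (\<lambda>s. s\<lparr>alive := d \<le> card (seen s)\<rparr>) @
     loop k (\<lambda>j. loop \<beta> (kill_round \<Delta> \<beta> j)) @
     update \<Delta> (\<lambda>s. s\<lparr>label := if alive s then cluster s else 0\<rparr>) @
     loop (2 * k) (\<lambda>_. spread \<Delta>) @
     finish \<Delta>"

text \<open>The predicate sees only the first components, since the registers are scratch space that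
  each gather sets anew.\<close>

lemma run_loop:
  assumes "P 0 (fst \<circ> c)"
    and "\<And>i c. i < k \<Longrightarrow> P i (fst \<circ> c) \<Longrightarrow> P (Suc i) (fst \<circ> run m E (p i) c)"
  shows "P k (fst \<circ> run m E (loop k p) c)"
  using assms(2)
proof (induction k)
  case 0
  then show ?case using assms(1) by (simp only: loop_def upt_0 list.map concat.simps run_Nil)
next
  case (Suc k)
  have "P k (fst \<circ> run m E (loop k p) c)"
    by (rule Suc.IH) (rule Suc.prems, simp_all)
  moreover have "run m E (loop (Suc k) p) c = run m E (p k) (run m E (loop k p) c)"
    by (simp add: loop_def run_append)
  ultimately show ?case
    unfolding \<open>run m E (loop (Suc k) p) c = _\<close> by (intro Suc.prems lessI)
qed

text \<open>Until the final announcement an edge may be known only to the endpoint that chose it, so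
  adjacency in the spanner has to be symmetrized.\<close>

definition link :: "(nat \<Rightarrow> nat set) \<Rightarrow> nat \<Rightarrow> nat \<Rightarrow> bool" where
  "link \<Phi> a b \<longleftrightarrow> b \<in> \<Phi> a \<or> a \<in> \<Phi> b"

definition linked :: "(nat \<Rightarrow> nat set) \<Rightarrow> (nat \<Rightarrow> nat) \<Rightarrow> nat \<Rightarrow> nat \<Rightarrow> bool" where
  "linked \<Phi> \<kappa> a b \<longleftrightarrow> link \<Phi> a b \<and> \<kappa> a \<noteq> 0 \<and> \<kappa> a = \<kappa> b"

lemma link_sym: "link \<Phi> a b \<Longrightarrow> link \<Phi> b a"
  by (auto simp: link_def)

lemma linked_sym: "linked \<Phi> \<kappa> a b \<Longrightarrow> linked \<Phi> \<kappa> b a"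
  by (auto simp: linked_def link_def)

text \<open>When clusters are merged, routes must be re-read with respect to the new labels. A route
  inside an old cluster survives because it never leaves that cluster, which receives one label as a
  whole.\<close>

lemma near_linked_restrict:
  assumes "near (linked \<Phi> \<kappa>) k u v"
  shows "near (\<lambda>a b. linked \<Phi> \<kappa> a b \<and> \<kappa> a = \<kappa> u) k u v"
  using assms
proof (induction k arbitrary: u)
  case (Suc k)
  then consider "near (linked \<Phi> \<kappa>) k u v" | w where "linked \<Phi> \<kappa> u w" "near (linked \<Phi> \<kappa>) k w v"
    by auto
  then show ?case
  proof cases
    case 1
    from Suc.IH[OF this] show ?thesis by simp
  next
    case 2
    have "\<kappa> w = \<kappa> u" using 2(1) by (simp add: linked_def)
    then have "near (\<lambda>a b. linked \<Phi> \<kappa> a b \<and> \<kappa> a = \<kappa> u) k w v"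
      using Suc.IH[OF 2(2)] by simp
    with 2(1) show ?thesis by auto
  qed
qed simp

section \<open>The state of the clustering between phases\<close>

context graph
begin

lemma
  assumes "gathered E \<kappa> b X T e"
  shows gathered_retired: "\<kappa> v = 0 \<Longrightarrow> T v = 0"
    and gathered_cong: "\<kappa> v = \<kappa> w \<Longrightarrow> T v = T w"
    and gathered_witness: "T v \<noteq> 0 \<Longrightarrow> \<exists>w u. \<kappa> w = \<kappa> v \<and> {w, u} \<in> E \<and> b u = T v \<and> b u \<notin> X w"
    and gathered_max: "\<kappa> w \<noteq> 0 \<Longrightarrow> {w, u} \<in> E \<Longrightarrow> b u \<notin> X w \<Longrightarrow> b u \<le> T w"
    and gathered_edge: "u \<in> e v \<Longrightarrow> {v, u} \<in> E \<and> b u = T v \<and> T v \<noteq> 0"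
    and gathered_unique: "T v \<noteq> 0 \<Longrightarrow>
      \<exists>x. \<kappa> x = \<kappa> v \<and> card (e x) = 1 \<and> (\<forall>w. \<kappa> w = \<kappa> v \<and> w \<noteq> x \<longrightarrow> e w = {})"
proof -
  have *: "\<forall>v. \<kappa> v = 0 \<longrightarrow> T v = 0 \<and> e v = {}" "\<forall>v w. \<kappa> v = \<kappa> w \<longrightarrow> T v = T w"
    "\<forall>v. T v \<noteq> 0 \<longrightarrow> (\<exists>w u. \<kappa> w = \<kappa> v \<and> {w, u} \<in> E \<and> b u = T v \<and> b u \<notin> X w)"
    "\<forall>w u. \<kappa> w \<noteq> 0 \<and> {w, u} \<in> E \<and> b u \<notin> X w \<longrightarrow> b u \<le> T w"
    "\<forall>v u. u \<in> e v \<longrightarrow> {v, u} \<in> E \<and> b u = T v \<and> T v \<noteq> 0"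
    "\<forall>v. T v \<noteq> 0 \<longrightarrow> (\<exists>x. \<kappa> x = \<kappa> v \<and> card (e x) = 1 \<and> (\<forall>w. \<kappa> w = \<kappa> v \<and> w \<noteq> x \<longrightarrow> e w = {}))"
    using assms unfolding gathered_def by - (elim conjE, assumption)+
  show "\<kappa> v = 0 \<Longrightarrow> T v = 0" using *(1) by blast
  show "\<kappa> v = \<kappa> w \<Longrightarrow> T v = T w" by (rule *(2)[rule_format])
  show "T v \<noteq> 0 \<Longrightarrow> \<exists>w u. \<kappa> w = \<kappa> v \<and> {w, u} \<in> E \<and> b u = T v \<and> b u \<notin> X w"
    by (rule *(3)[rule_format])
  show "\<kappa> w \<noteq> 0 \<Longrightarrow> {w, u} \<in> E \<Longrightarrow> b u \<notin> X w \<Longrightarrow> b u \<le> T w"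
    using *(4) by blast
  show "u \<in> e v \<Longrightarrow> {v, u} \<in> E \<and> b u = T v \<and> T v \<noteq> 0"
    by (rule *(5)[rule_format])
  show "T v \<noteq> 0 \<Longrightarrow>
      \<exists>x. \<kappa> x = \<kappa> v \<and> card (e x) = 1 \<and> (\<forall>w. \<kappa> w = \<kappa> v \<and> w \<noteq> x \<longrightarrow> e w = {})"
    by (rule *(6)[rule_format])
qed

lemma gathered_live:
  assumes "gathered E \<kappa> b X T e" "T v \<noteq> 0"
  shows "\<kappa> v \<noteq> 0"
proof
  assume "\<kappa> v = 0"
  then have "T v = 0" by (rule gathered_retired[OF assms(1)])
  with assms(2) show False ..
qed

lemma gathered_new_edge:
  assumes "gathered E \<kappa> b X T e" "T v \<noteq> 0"
  shows "\<exists>x y. \<kappa> x = \<kappa> v \<and> T x = T v \<and> y \<in> e x \<and> {x, y} \<in> E \<and> b y = T v"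
proof -
  obtain x where x: "\<kappa> x = \<kappa> v" "card (e x) = 1"
    using gathered_unique[OF assms] by (elim exE conjE)
  then obtain y where y: "y \<in> e x" by (metis card.empty equals0I zero_neq_one)
  have "T x = T v" using x(1) by (rule gathered_cong[OF assms(1)])
  with gathered_edge[OF assms(1) y] x(1) y show ?thesis
    by (intro exI[of _ x] exI[of _ y]) simp
qed

text \<open>\<open>D\<close> bounds diameters along chosen edges that stay inside the cluster,
  \<open>N\<close> the number of clusters and \<open>M\<close> the number of choices, where an edge
  chosen by both ends counts twice. The detour \<open>2 * D + 1\<close> crosses one cluster, one
  edge, and a second cluster. Nothing is claimed yet about edges with both ends in live
  clusters.\<close>

definition invariant :: "nat \<Rightarrow> nat \<Rightarrow> nat \<Rightarrow> (nat \<Rightarrow> vertex_state) \<Rightarrow> bool" where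
  "invariant D N M s \<longleftrightarrow>
    (\<forall>v. cluster (s v) \<noteq> 0 \<longrightarrow> v \<in> V \<and> cluster (s v) \<le> m) \<and>
    (\<forall>v u. u \<in> chosen (s v) \<longrightarrow> {v, u} \<in> E) \<and>
    (\<forall>u v. cluster (s u) \<noteq> 0 \<longrightarrow> cluster (s u) = cluster (s v) \<longrightarrow>
      near (linked (\<lambda>v. chosen (s v)) (\<lambda>v. cluster (s v))) D u v) \<and>
    (\<forall>v. seen (s v) = {} \<and> pending (s v) = {}) \<and>
    card (range (\<lambda>v. cluster (s v)) - {0}) \<le> N \<and>
    (\<Sum>v\<in>V. card (chosen (s v))) \<le> M \<and>
    (\<forall>u v. {u, v} \<in> E \<longrightarrow> cluster (s u) = 0 \<or> cluster (s v) = 0 \<longrightarrow>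
      near (link (\<lambda>v. chosen (s v))) (2 * D + 1) u v)"

lemma gathered_sum:
  assumes "gathered E \<kappa> b X T e" "T v \<noteq> 0" "finite {w. \<kappa> w = \<kappa> v}"
  shows "(\<Sum>w | \<kappa> w = \<kappa> v. card (e w)) = 1"
proof -
  obtain x where x: "\<kappa> x = \<kappa> v" "card (e x) = 1" "\<And>w. \<kappa> w = \<kappa> v \<Longrightarrow> w \<noteq> x \<Longrightarrow> e w = {}"
    using gathered_unique[OF assms(1,2)] by blast
  have "(\<Sum>w\<in>{w. \<kappa> w = \<kappa> v} - {x}. card (e w)) = 0"
    using x(3) by (intro sum.neutral) auto
  then show ?thesis
    using sum.remove[OF assms(3), of x "\<lambda>w. card (e w)"] x by simp
qed

end

text \<open>A snapshot taken at the start of a phase. The field \<open>cluster\<close> changes only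
  in \<open>finish\<close>, and \<open>\<Phi>\<close> keeps the edges chosen earlier, so the
  diameter bound stays available while \<open>chosen\<close> grows.\<close>

locale clustering = graph +
  fixes \<kappa> :: "nat \<Rightarrow> nat" and \<Phi> :: "nat \<Rightarrow> nat set" and D :: nat and \<Delta> :: nat
  assumes cluster_range: "\<kappa> v \<noteq> 0 \<Longrightarrow> v \<in> V \<and> \<kappa> v \<le> m"
    and chosen_edge: "u \<in> \<Phi> v \<Longrightarrow> {v, u} \<in> E"
    and diam: "\<kappa> u \<noteq> 0 \<Longrightarrow> \<kappa> u = \<kappa> v \<Longrightarrow> near (linked \<Phi> \<kappa>) D u v"
    and diam_le: "D \<le> \<Delta>"
begin

lemma finite_cluster: "a \<noteq> 0 \<Longrightarrow> finite {v. \<kappa> v = a}"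
  by (rule finite_subset[OF _ finite_V]) (use cluster_range in auto)

definition clusters :: "nat set" where
  "clusters = range \<kappa> - {0}"

lemma clusters_subset: "clusters \<subseteq> \<kappa> ` V"
  using cluster_range by (auto simp: clusters_def)

lemma finite_clusters: "finite clusters"
  using clusters_subset finite_V finite_surj by blast

definition adj :: "nat \<Rightarrow> nat \<Rightarrow> bool" where
  "adj a b \<longleftrightarrow> a \<noteq> b \<and> a \<noteq> 0 \<and> b \<noteq> 0 \<and> (\<exists>u v. \<kappa> u = a \<and> \<kappa> v = b \<and> {u, v} \<in> E)"

lemma adj_sym: "adj a b \<Longrightarrow> adj b a"
  unfolding adj_def using edge_sym by metis

lemma adj_clusters: "adj a b \<Longrightarrow> a \<in> clusters \<and> b \<in> clusters"
  unfolding adj_def clusters_def by blast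

lemma finite_adj: "finite {b. adj a b}"
  by (rule finite_subset[OF _ finite_clusters]) (use adj_clusters in blast)

text \<open>Diameters are measured along chosen edges, whereas flooding may use every edge inside a
  cluster. So \<open>\<Delta>\<close> rounds suffice as soon as
  \<open>D \<le> \<Delta>\<close>.\<close>

lemma gather_step:
  assumes "\<And>v. cluster (fst (c v)) = \<kappa> v" "\<And>v. b (fst (c v)) \<le> m"
  obtains T e where "gathered E \<kappa> (\<lambda>v. b (fst (c v))) (\<lambda>v. X (fst (c v))) T e"
    "\<And>v. fst (run m E (gather \<Delta> b X f) c v) = f (fst (c v)) (T v) (e v)"
proof -
  have \<kappa>: "cluster \<circ> (fst \<circ> c) = \<kappa>" using assms(1) by auto
  have "near (same_cluster E \<kappa>) \<Delta> u v" if "\<kappa> u \<noteq> 0" "\<kappa> u = \<kappa> v" for u v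
  proof (rule near_mono[OF diam[OF that] diam_le])
    fix a b assume "linked \<Phi> \<kappa> a b"
    then show "same_cluster E \<kappa> a b"
      using chosen_edge edge_sym unfolding linked_def link_def same_cluster_def by metis
  qed
  then obtain T e where "gathered E \<kappa> (b \<circ> (fst \<circ> c)) (X \<circ> (fst \<circ> c)) T e"
    "fst \<circ> run m E (gather \<Delta> b X f) c = (\<lambda>v. f ((fst \<circ> c) v) (T v) (e v))"
    using run_gather[of c b \<Delta> X f] cluster_range assms(2) unfolding \<kappa> by auto
  then show ?thesis
    using that by (simp add: comp_def fun_eq_iff)
qed

lemma update_step:
  assumes "\<And>v. cluster (fst (c v)) = \<kappa> v"
  shows "fst (run m E (update \<Delta> f) c v) = f (fst (c v))"
  unfolding update_def
  by (rule gather_step[of c "\<lambda>_. 0" "\<lambda>_. {}" "\<lambda>s _ _. f s"]) (use assms in auto)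

section \<open>Learning neighboring clusters\<close>

definition explored :: "nat \<Rightarrow> (nat \<Rightarrow> nat set) \<Rightarrow> (nat \<Rightarrow> vertex_state) \<Rightarrow> bool" where
  "explored i S s \<longleftrightarrow>
    (\<forall>v. cluster (s v) = \<kappa> v \<and> chosen (s v) = \<Phi> v \<and> seen (s v) = S (\<kappa> v)) \<and>
    (\<forall>v u. u \<in> pending (s v) \<longrightarrow> {v, u} \<in> E \<and> \<kappa> v \<noteq> 0) \<and>
    (\<forall>a. S a \<subseteq> {b. adj a b} \<and> card (S a) \<le> i \<and> (card (S a) = i \<or> S a = {b. adj a b})) \<and>
    (\<forall>a. \<forall>b\<in>S a. \<exists>x y. \<kappa> x = a \<and> y \<in> pending (s x) \<and> \<kappa> y = b) \<and>
    (\<forall>a. a \<noteq> 0 \<longrightarrow> (\<Sum>v | \<kappa> v = a. card (pending (s v))) \<le> card (S a))"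

lemma exploredD:
  assumes "explored i S s"
  shows "cluster (s v) = \<kappa> v" "chosen (s v) = \<Phi> v" "seen (s v) = S (\<kappa> v)"
    and "u \<in> pending (s v) \<Longrightarrow> {v, u} \<in> E \<and> \<kappa> v \<noteq> 0"
    and "S a \<subseteq> {b. adj a b}" "card (S a) \<le> i" "card (S a) = i \<or> S a = {b. adj a b}"
    and "b \<in> S a \<Longrightarrow> \<exists>x y. \<kappa> x = a \<and> y \<in> pending (s x) \<and> \<kappa> y = b"
    and "a \<noteq> 0 \<Longrightarrow> (\<Sum>v | \<kappa> v = a. card (pending (s v))) \<le> card (S a)"
proof -
  note h = assms[unfolded explored_def]
  note h1 = conjunct1[OF h] and h2 = conjunct1[OF conjunct2[OF h]]
    and h3 = conjunct1[OF conjunct2[OF conjunct2[OF h]]]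
    and h4 = conjunct1[OF conjunct2[OF conjunct2[OF conjunct2[OF h]]]]
    and h5 = conjunct2[OF conjunct2[OF conjunct2[OF conjunct2[OF h]]]]
  show "cluster (s v) = \<kappa> v" "chosen (s v) = \<Phi> v" "seen (s v) = S (\<kappa> v)"
    using h1[rule_format, of v] by - (elim conjE, assumption)+
  show "u \<in> pending (s v) \<Longrightarrow> {v, u} \<in> E \<and> \<kappa> v \<noteq> 0" by (rule h2[rule_format])
  show "S a \<subseteq> {b. adj a b}" "card (S a) \<le> i" "card (S a) = i \<or> S a = {b. adj a b}"
    using h3[rule_format, of a] by - (elim conjE, assumption)+
  show "b \<in> S a \<Longrightarrow> \<exists>x y. \<kappa> x = a \<and> y \<in> pending (s x) \<and> \<kappa> y = b" by (rule h4[rule_format])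
  show "a \<noteq> 0 \<Longrightarrow> (\<Sum>v | \<kappa> v = a. card (pending (s v))) \<le> card (S a)" by (rule h5[rule_format])
qed

text \<open>The gathered value 0 means that no unseen live neighboring cluster exists, so the list
  is complete; a nonzero value is a new one. Hence having seen fewer than \<open>i\<close> clusters
  after \<open>i\<close> calls certifies that all neighbors are known, which is what lets a cluster
  retire safely.\<close>

lemma run_explore:
  assumes "explored i S (fst \<circ> c)"
  shows "\<exists>S'. explored (Suc i) S' (fst \<circ> run m E (explore \<Delta>) c)"
proof -
  define s where "s = fst \<circ> c"
  define s' where "s' = fst \<circ> run m E (explore \<Delta>) c"
  have fst_c: "fst (c v) = s v" for v by (simp add: s_def)
  note h = exploredD[OF assms, folded s_def]
  note s = h(1-3) and pend = h(4) and S = h(5-7) and edge = h(8) and count = h(9)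
  have "\<kappa> v \<le> m" for v using cluster_range[of v] by (cases "\<kappa> v = 0") auto
  with s(1) fst_c have "\<And>v. cluster (fst (c v)) = \<kappa> v" "\<And>v. cluster (fst (c v)) \<le> m" by auto
  then obtain T e where "gathered E \<kappa> (\<lambda>v. cluster (fst (c v)))
      (\<lambda>v. insert (cluster (fst (c v))) (seen (fst (c v)))) T e"
    and run: "\<And>v. fst (run m E (explore \<Delta>) c v) = (if T v = 0 then fst (c v)
      else (fst (c v))\<lparr>seen := insert (T v) (seen (fst (c v))), pending := pending (fst (c v)) \<union> e v\<rparr>)"
    by (rule gather_step[of c cluster "\<lambda>s. insert (cluster s) (seen s)"
       "\<lambda>s t e. if t = 0 then s else s\<lparr>seen := insert t (seen s), pending := pending s \<union> e\<rparr>", folded explore_def]) (rule that)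
  then have G: "gathered E \<kappa> \<kappa> (\<lambda>v. insert (\<kappa> v) (S (\<kappa> v))) T e"
    by (simp add: s fst_c)
  have s': "cluster (s' v) = \<kappa> v" "chosen (s' v) = \<Phi> v"
    "seen (s' v) = (if T v = 0 then S (\<kappa> v) else insert (T v) (S (\<kappa> v)))"
    "pending (s' v) = (if T v = 0 then pending (s v) else pending (s v) \<union> e v)" for v
    using s[of v] by (simp_all add: s'_def run fst_c)
  \<comment> \<open>\<open>T\<close> is constant on each cluster, so any preimage under
    \<open>\<kappa>\<close> may represent it. Numbers that are not cluster IDs keep their old
    value.\<close>
  define S' where "S' a = (if a \<in> range \<kappa> \<and> T (inv \<kappa> a) \<noteq> 0 then insert (T (inv \<kappa> a)) (S a) else S a)" for a
  have T_inv: "T (inv \<kappa> (\<kappa> v)) = T v" for v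
    by (rule gathered_cong[OF G]) (simp add: f_inv_into_f)
  have S': "S' (\<kappa> v) = (if T v = 0 then S (\<kappa> v) else insert (T v) (S (\<kappa> v)))" for v
    by (simp add: S'_def T_inv)
  have T_new: "adj (\<kappa> v) (T v) \<and> T v \<notin> S (\<kappa> v)" if nz: "T v \<noteq> 0" for v
  proof -
    obtain w u where "\<kappa> w = \<kappa> v" "{w, u} \<in> E" "\<kappa> u = T v" "\<kappa> u \<notin> insert (\<kappa> w) (S (\<kappa> w))"
      using gathered_witness[OF G nz] by blast
    moreover have "\<kappa> v \<noteq> 0" using G nz by (rule gathered_live)
    ultimately show ?thesis using nz unfolding adj_def by (metis insertCI)
  qed
  have full: "S (\<kappa> v) = {b. adj (\<kappa> v) b}" if "T v = 0" for v
  proof -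
    have "b \<in> S (\<kappa> v)" if b: "adj (\<kappa> v) b" for b
    proof (rule ccontr)
      assume "b \<notin> S (\<kappa> v)"
      obtain w u where wu: "\<kappa> w = \<kappa> v" "\<kappa> u = b" "{w, u} \<in> E" "\<kappa> v \<noteq> b" "\<kappa> v \<noteq> 0" "b \<noteq> 0"
        using b unfolding adj_def by blast
      have "\<kappa> u \<le> T w"
        by (rule gathered_max[OF G _ wu(3)]) (use wu \<open>b \<notin> S (\<kappa> v)\<close> in auto)
      also have "T w = T v" by (rule gathered_cong[OF G wu(1)])
      finally show False using wu \<open>T v = 0\<close> by simp
    qed
    then show ?thesis using S(1) by blast
  qed
  have "explored (Suc i) S' s'"
    unfolding explored_def
  proof (intro conjI allI impI ballI)
    fix v show "seen (s' v) = S' (\<kappa> v)" by (simp add: s' S')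
  next
    fix v u assume "u \<in> pending (s' v)"
    then consider "u \<in> pending (s v)" | "u \<in> e v" by (auto simp: s' split: if_splits)
    then have "{v, u} \<in> E \<and> \<kappa> v \<noteq> 0"
    proof cases
      case 1
      then show ?thesis by (rule pend)
    next
      case 2
      from gathered_edge[OF G 2] have "{v, u} \<in> E" "T v \<noteq> 0" by simp_all
      with gathered_live[OF G] show ?thesis by simp
    qed
    then show "{v, u} \<in> E" "\<kappa> v \<noteq> 0" by simp_all
  next
    fix a
    have fin: "finite (S a)" using S(1) finite_adj finite_subset by blast
    show "S' a \<subseteq> {b. adj a b}" "card (S' a) \<le> Suc i" "card (S' a) = Suc i \<or> S' a = {b. adj a b}"
    proof -
      consider v where "a = \<kappa> v" "T v \<noteq> 0" | v where "a = \<kappa> v" "T v = 0" | "a \<notin> range \<kappa>" by blast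
      then have "S' a \<subseteq> {b. adj a b} \<and> card (S' a) \<le> Suc i \<and> (card (S' a) = Suc i \<or> S' a = {b. adj a b})"
      proof cases
        case 1
        have "S a \<noteq> {b. adj a b}" using T_new[OF 1(2)] 1(1) by blast
        then have "card (S a) = i" using S(3) by blast
        moreover have "S' a = insert (T v) (S a)" using 1 by (simp add: S')
        ultimately show ?thesis using T_new[OF 1(2)] fin S(1)[of a] 1(1) by auto
      next
        case 2
        then have "S' a = S a" by (simp add: S')
        then show ?thesis using full[OF 2(2)] S(2)[of a] 2(1) by auto
      next
        case 3
        then have "S' a = S a" "{b. adj a b} = {}" by (auto simp: S'_def adj_def)
        then show ?thesis using S(1)[of a] by auto
      qed
      then show "S' a \<subseteq> {b. adj a b}" "card (S' a) \<le> Suc i" "card (S' a) = Suc i \<or> S' a = {b. adj a b}"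
        by blast+
    qed
  next
    fix a b assume b: "b \<in> S' a"
    consider "b \<in> S a" | v where "a = \<kappa> v" "T v \<noteq> 0" "b = T v"
      using b by (auto simp: S'_def T_inv split: if_splits)
    then show "\<exists>x y. \<kappa> x = a \<and> y \<in> pending (s' x) \<and> \<kappa> y = b"
    proof cases
      case 1
      from edge[OF this] show ?thesis by (auto simp: s')
    next
      case 2
      obtain x y where xy: "\<kappa> x = \<kappa> v" "T x = T v" "y \<in> e x" "\<kappa> y = T v"
        using gathered_new_edge[OF G 2(2)] by (elim exE conjE)
      then have "y \<in> pending (s' x)" using 2(2) by (simp add: s')
      then show ?thesis using xy 2 by (intro exI[of _ x] exI[of _ y]) simp
    qed
  next
    fix a :: nat assume a: "a \<noteq> 0"
    show "(\<Sum>v | \<kappa> v = a. card (pending (s' v))) \<le> card (S' a)"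
    proof (cases "\<exists>v. a = \<kappa> v \<and> T v \<noteq> 0")
      case True
      then obtain v where v: "a = \<kappa> v" "T v \<noteq> 0" by blast
      have "(\<Sum>w | \<kappa> w = a. card (pending (s' w)))
        \<le> (\<Sum>w | \<kappa> w = a. card (pending (s w)) + card (e w))"
        by (intro sum_mono) (auto simp: s' intro: card_Un_le)
      also have "\<dots> \<le> card (S a) + 1"
        using gathered_sum[OF G v(2)] finite_cluster[OF a] count[OF a] v(1) by (simp add: sum.distrib)
      also have "\<dots> = card (S' a)"
        using T_new[OF v(2)] v finite_subset[OF S(1) finite_adj] by (simp add: S')
      finally show ?thesis .
    next
      case False
      then have "S' a = S a" "\<And>v. \<kappa> v = a \<Longrightarrow> T v = 0" by (auto simp: S'_def T_inv)
      then show ?thesis using count[OF a] by (simp add: s')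
    qed
  qed (simp_all add: s')
  then show ?thesis unfolding s'_def by (rule exI[of _ S'])
qed

section \<open>Selecting well-separated clusters of high degree\<close>

definition ruled :: "(nat \<Rightarrow> nat set) \<Rightarrow> nat set \<Rightarrow> (nat \<Rightarrow> vertex_state) \<Rightarrow> bool" where
  "ruled P A s \<longleftrightarrow> (\<forall>v. cluster (s v) = \<kappa> v \<and> chosen (s v) = \<Phi> v \<and> pending (s v) = P v \<and>
     (alive (s v) \<longleftrightarrow> \<kappa> v \<in> A))"

lemma adjE:
  assumes "adj a b"
  obtains w u where "\<kappa> w = a" "\<kappa> u = b" "{w, u} \<in> E" "a \<noteq> 0"
  using assms unfolding adj_def by (elim exE conjE) (rule that)

lemma cluster_le: "\<kappa> v \<le> m"
  using cluster_range[of v] by (cases "\<kappa> v = 0") auto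

lemma gathered_le:
  assumes "gathered E \<kappa> b X T e" "\<And>v. b v \<le> m"
  shows "T v \<le> m"
proof (cases "T v = 0")
  case False
  then obtain u where "b u = T v" using gathered_witness[OF assms(1) False] by (elim exE conjE)
  then show ?thesis using assms(2)[of u] by simp
qed simp

text \<open>One hop in the cluster graph. As no value is excluded, a vertex also hears members of
  its own cluster, so a nonzero \<open>T v\<close> alone does not point to a neighbor; the disjunct
  \<open>H (\<kappa> v)\<close> on both sides absorbs this.\<close>

lemma gathered_nonzero_iff:
  assumes G: "gathered E \<kappa> b (\<lambda>_. {}) T e"
    and b: "\<And>u. b u \<noteq> 0 \<longleftrightarrow> \<kappa> u \<noteq> 0 \<and> H (\<kappa> u)" and v: "\<kappa> v \<noteq> 0"
  shows "H (\<kappa> v) \<or> T v \<noteq> 0 \<longleftrightarrow> H (\<kappa> v) \<or> (\<exists>a. adj (\<kappa> v) a \<and> H a)"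
proof -
  have "\<exists>a. adj (\<kappa> v) a \<and> H a" if nz: "T v \<noteq> 0" and "\<not> H (\<kappa> v)"
  proof -
    obtain w u where wu: "\<kappa> w = \<kappa> v" "{w, u} \<in> E" "b u = T v"
      using gathered_witness[OF G nz] by (elim exE conjE)
    have u: "\<kappa> u \<noteq> 0" "H (\<kappa> u)" using b[of u] nz wu(3) by simp_all
    with \<open>\<not> H (\<kappa> v)\<close> have "\<kappa> v \<noteq> \<kappa> u" by metis
    then have "adj (\<kappa> v) (\<kappa> u)" unfolding adj_def using wu u(1) v by blast
    with u show ?thesis by blast
  qed
  moreover have "T v \<noteq> 0" if a: "adj (\<kappa> v) a" "H a" for a
  proof -
    obtain u w where wu: "\<kappa> w = \<kappa> v" "\<kappa> u = a" "{w, u} \<in> E" "a \<noteq> 0"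
      by (rule adjE[OF adj_sym[OF a(1)]]) (rule that, assumption, assumption, simp_all add: insert_commute)
    have "b u \<noteq> 0" using b[of u] wu a(2) by simp
    moreover have "b u \<le> T w"
      by (rule gathered_max[OF G _ wu(3)]) (use v wu(1) in simp_all)
    moreover have "T w = T v" by (rule gathered_cong[OF G wu(1)])
    ultimately show ?thesis by simp
  qed
  ultimately show ?thesis by blast
qed

lemma run_kill_round:
  assumes ruled: "ruled P A (fst \<circ> c)" and A: "A \<subseteq> clusters"
  shows "ruled P (kill (near adj 2) \<beta> j x A) (fst \<circ> run m E (kill_round \<Delta> \<beta> j x) c)"
proof -
  let ?b = "\<lambda>s. if selected \<beta> j x s then cluster s else 0"
  let ?f1 = "\<lambda>s t _. s\<lparr>mark := if selected \<beta> j x s then cluster s else t\<rparr>"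
  let ?f2 = "\<lambda>s t _. if x < digit \<beta> j (cluster s) \<and> (mark s \<noteq> 0 \<or> t \<noteq> 0) then s\<lparr>alive := False\<rparr> else s"
  define c1 where "c1 = run m E (gather \<Delta> ?b (\<lambda>_. {}) ?f1) c"
  define c2 where "c2 = run m E (gather \<Delta> mark (\<lambda>_. {}) ?f2) c1"
  define B where "B = {a \<in> A. digit \<beta> j a = x}"
  \<comment> \<open>\<open>H\<close> is what the marks record, namely distance at most 1 from
    \<open>B\<close>. Using \<open>gathered_nonzero_iff\<close> again with \<open>H\<close> as the
    predicate yields distance 2.\<close>
  define H where "H a \<longleftrightarrow> a \<in> B \<or> (\<exists>b. adj a b \<and> b \<in> B)" for a
  have s: "cluster (fst (c v)) = \<kappa> v" "chosen (fst (c v)) = \<Phi> v" "pending (fst (c v)) = P v"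
    "alive (fst (c v)) \<longleftrightarrow> \<kappa> v \<in> A" for v
    using ruled[unfolded ruled_def, rule_format, of v] by simp_all
  have sel: "selected \<beta> j x (fst (c v)) \<longleftrightarrow> \<kappa> v \<in> B" for v
    by (simp add: selected_def s B_def)
  have "0 \<notin> B" using A by (auto simp: B_def clusters_def)
  have b: "?b (fst (c v)) = (if \<kappa> v \<in> B then \<kappa> v else 0)" for v
    by (simp add: sel s)
  have b_le: "?b (fst (c v)) \<le> m" for v
    by (simp add: b cluster_le)
  obtain T1 e1 where "gathered E \<kappa> (\<lambda>v. ?b (fst (c v))) (\<lambda>v. {}) T1 e1"
    and run1: "\<And>v. fst (c1 v) = ?f1 (fst (c v)) (T1 v) (e1 v)"
    by (rule gather_step[of c ?b "\<lambda>_. {}" ?f1, OF s(1) b_le, folded c1_def]) (rule that)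
  then have G1: "gathered E \<kappa> (\<lambda>v. if \<kappa> v \<in> B then \<kappa> v else 0) (\<lambda>v. {}) T1 e1"
    by (simp only: b)
  have T1_le: "T1 v \<le> m" for v
    by (rule gathered_le[OF G1]) (simp add: cluster_le)
  have s1: "cluster (fst (c1 v)) = \<kappa> v" "chosen (fst (c1 v)) = \<Phi> v" "pending (fst (c1 v)) = P v"
    "alive (fst (c1 v)) \<longleftrightarrow> \<kappa> v \<in> A" "mark (fst (c1 v)) = (if \<kappa> v \<in> B then \<kappa> v else T1 v)" for v
    by (simp_all add: run1 s sel)
  have mark_le: "mark (fst (c1 v)) \<le> m" for v
    by (simp add: s1 cluster_le T1_le)
  have mark: "mark (fst (c1 v)) \<noteq> 0 \<longleftrightarrow> \<kappa> v \<noteq> 0 \<and> H (\<kappa> v)" for v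
  proof (cases "\<kappa> v = 0")
    case True
    then show ?thesis using gathered_retired[OF G1 True] by (simp add: s1)
  next
    case False
    have "\<kappa> v \<in> B \<or> T1 v \<noteq> 0 \<longleftrightarrow> H (\<kappa> v)"
      unfolding H_def
      by (rule gathered_nonzero_iff[OF G1 _ False]) simp
    with False show ?thesis by (cases "\<kappa> v \<in> B") (simp_all add: s1)
  qed
  obtain T2 e2 where G2: "gathered E \<kappa> (\<lambda>v. mark (fst (c1 v))) (\<lambda>v. {}) T2 e2"
    and run2: "\<And>v. fst (c2 v) = ?f2 (fst (c1 v)) (T2 v) (e2 v)"
    by (rule gather_step[of c1 mark "\<lambda>_. {}" ?f2, OF s1(1) mark_le, folded c2_def]) (rule that)
  have hit: "mark (fst (c1 v)) \<noteq> 0 \<or> T2 v \<noteq> 0 \<longleftrightarrow> (\<exists>b\<in>B. near adj 2 (\<kappa> v) b)" if "\<kappa> v \<in> A" for v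
  proof -
    have v: "\<kappa> v \<noteq> 0" using that A by (auto simp: clusters_def)
    have "mark (fst (c1 v)) \<noteq> 0 \<or> T2 v \<noteq> 0 \<longleftrightarrow> H (\<kappa> v) \<or> (\<exists>a. adj (\<kappa> v) a \<and> H a)"
      using gathered_nonzero_iff[OF G2 mark v] mark[of v] v by simp
    also have "\<dots> \<longleftrightarrow> (\<exists>b\<in>B. near adj 2 (\<kappa> v) b)"
      unfolding H_def near_2 by blast
    finally show ?thesis .
  qed
  have alive: "alive (fst (c2 v)) \<longleftrightarrow> \<kappa> v \<in> kill (near adj 2) \<beta> j x A" for v
  proof (cases "\<kappa> v \<in> A")
    case True
    have "alive (fst (c2 v)) \<longleftrightarrow> \<not> (x < digit \<beta> j (\<kappa> v) \<and> (\<exists>b\<in>B. near adj 2 (\<kappa> v) b))"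
      unfolding hit[OF True, symmetric] by (simp add: run2 s1 True)
    then show ?thesis using True unfolding kill_def B_def by blast
  next
    case False
    then show ?thesis by (simp add: run2 s1 kill_def)
  qed
  have "run m E (kill_round \<Delta> \<beta> j x) c = c2"
    unfolding kill_round_def run_append c1_def[symmetric] c2_def ..
  then show ?thesis
    unfolding ruled_def by (simp add: alive) (simp add: run2 s1)
qed

lemma run_ruling:
  assumes "ruled P A (fst \<circ> c)" "A \<subseteq> clusters"
  shows "ruled P (ruling (near adj 2) \<beta> k A)
    (fst \<circ> run m E (loop k (\<lambda>j. loop \<beta> (kill_round \<Delta> \<beta> j))) c)"
proof (rule run_loop[where P = "\<lambda>i. ruled P (ruling (near adj 2) \<beta> i A)"])
  fix j and c :: "nat \<Rightarrow> full_state" assume "ruled P (ruling (near adj 2) \<beta> j A) (fst \<circ> c)"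
  let ?R = "ruling (near adj 2) \<beta> j A"
  have "?R \<subseteq> clusters" using ruling_subset assms(2) by blast
  have "ruled P (sweep (near adj 2) \<beta> \<beta> j ?R) (fst \<circ> run m E (loop \<beta> (kill_round \<Delta> \<beta> j)) c)"
  proof (rule run_loop[where P = "\<lambda>x. ruled P (sweep (near adj 2) \<beta> x j ?R)"])
    show "ruled P (sweep (near adj 2) \<beta> 0 j ?R) (fst \<circ> c)" by (simp only: sweep_0) fact
  next
    fix x and c :: "nat \<Rightarrow> full_state" assume *: "ruled P (sweep (near adj 2) \<beta> x j ?R) (fst \<circ> c)"
    have "sweep (near adj 2) \<beta> x j ?R \<subseteq> clusters"
      using sweep_inv[of "near adj 2" \<beta> x j ?R] \<open>?R \<subseteq> clusters\<close> by blast
    from run_kill_round[OF * this]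
    show "ruled P (sweep (near adj 2) \<beta> (Suc x) j ?R) (fst \<circ> run m E (kill_round \<Delta> \<beta> j x) c)"
      unfolding sweep_Suc .
  qed
  then show "ruled P (ruling (near adj 2) \<beta> (Suc j) A)
      (fst \<circ> run m E (loop \<beta> (kill_round \<Delta> \<beta> j)) c)"
    unfolding ruling_Suc .
qed (use assms in simp)

section \<open>Absorbing the clusters around the selected ones\<close>

definition labelled ::
    "(nat \<Rightarrow> nat set) \<Rightarrow> nat set \<Rightarrow> nat \<Rightarrow> (nat \<Rightarrow> nat) \<Rightarrow> (nat \<Rightarrow> vertex_state) \<Rightarrow> bool" where
  "labelled P A i L s \<longleftrightarrow>
    (\<forall>v. cluster (s v) = \<kappa> v \<and> pending (s v) = P v \<and> label (s v) = L (\<kappa> v) \<and> \<Phi> v \<subseteq> chosen (s v)) \<and>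
    (\<forall>v u. u \<in> chosen (s v) \<longrightarrow> {v, u} \<in> E \<and> (u \<in> \<Phi> v \<or> \<kappa> v \<noteq> 0)) \<and>
    (\<forall>a. L a \<noteq> 0 \<longrightarrow> L a \<in> A \<and> a \<noteq> 0) \<and>
    (\<forall>a r. r \<in> A \<longrightarrow> near adj i a r \<longrightarrow> L a \<noteq> 0) \<and>
    (\<forall>v w. L (\<kappa> v) \<noteq> 0 \<longrightarrow> \<kappa> w = L (\<kappa> v) \<longrightarrow>
      near (linked (\<lambda>v. chosen (s v)) (\<lambda>v. L (\<kappa> v))) (i * (D + 1) + D) v w) \<and>
    (\<forall>a. a \<noteq> 0 \<longrightarrow> (\<Sum>v | \<kappa> v = a. card (chosen (s v))) \<le>
      (\<Sum>v | \<kappa> v = a. card (\<Phi> v)) + (if L a = 0 then 0 else 1))"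

lemma labelledD:
  assumes "labelled P A i L s"
  shows "cluster (s v) = \<kappa> v" "pending (s v) = P v" "label (s v) = L (\<kappa> v)" "\<Phi> v \<subseteq> chosen (s v)"
    and "u \<in> chosen (s v) \<Longrightarrow> {v, u} \<in> E \<and> (u \<in> \<Phi> v \<or> \<kappa> v \<noteq> 0)"
    and "L a \<noteq> 0 \<Longrightarrow> L a \<in> A \<and> a \<noteq> 0"
    and "r \<in> A \<Longrightarrow> near adj i a r \<Longrightarrow> L a \<noteq> 0"
    and "L (\<kappa> v) \<noteq> 0 \<Longrightarrow> \<kappa> w = L (\<kappa> v) \<Longrightarrow>
      near (linked (\<lambda>v. chosen (s v)) (\<lambda>v. L (\<kappa> v))) (i * (D + 1) + D) v w"
    and "a \<noteq> 0 \<Longrightarrow> (\<Sum>v | \<kappa> v = a. card (chosen (s v))) \<le>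
      (\<Sum>v | \<kappa> v = a. card (\<Phi> v)) + (if L a = 0 then 0 else 1)"
proof -
  note h = assms[unfolded labelled_def]
  note h1 = conjunct1[OF h] and h2 = conjunct1[OF conjunct2[OF h]]
    and h3 = conjunct1[OF conjunct2[OF conjunct2[OF h]]]
    and h4 = conjunct1[OF conjunct2[OF conjunct2[OF conjunct2[OF h]]]]
    and h5 = conjunct1[OF conjunct2[OF conjunct2[OF conjunct2[OF conjunct2[OF h]]]]]
    and h6 = conjunct2[OF conjunct2[OF conjunct2[OF conjunct2[OF conjunct2[OF h]]]]]
  show "cluster (s v) = \<kappa> v" "pending (s v) = P v" "label (s v) = L (\<kappa> v)" "\<Phi> v \<subseteq> chosen (s v)"
    using h1[rule_format, of v] by - (elim conjE, assumption)+
  show "u \<in> chosen (s v) \<Longrightarrow> {v, u} \<in> E \<and> (u \<in> \<Phi> v \<or> \<kappa> v \<noteq> 0)"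
    by (rule h2[rule_format])
  show "L a \<noteq> 0 \<Longrightarrow> L a \<in> A \<and> a \<noteq> 0" by (rule h3[rule_format])
  show "r \<in> A \<Longrightarrow> near adj i a r \<Longrightarrow> L a \<noteq> 0" by (rule h4[rule_format])
  show "L (\<kappa> v) \<noteq> 0 \<Longrightarrow> \<kappa> w = L (\<kappa> v) \<Longrightarrow>
      near (linked (\<lambda>v. chosen (s v)) (\<lambda>v. L (\<kappa> v))) (i * (D + 1) + D) v w"
    by (rule h5[rule_format])
  show "a \<noteq> 0 \<Longrightarrow> (\<Sum>v | \<kappa> v = a. card (chosen (s v))) \<le>
      (\<Sum>v | \<kappa> v = a. card (\<Phi> v)) + (if L a = 0 then 0 else 1)"
    by (rule h6[rule_format])
qed

text \<open>A newly labelled cluster is left by crossing it to the elected vertex and using its new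
  edge, at a cost of \<open>D + 1\<close>; then the route of an already labelled vertex takes over.
  The final \<open>D\<close> in the bound crosses the selected cluster, so that every member
  \<open>w\<close> of it is reached.\<close>

lemma run_spread:
  assumes A: "A \<subseteq> clusters" and L: "labelled P A i L (fst \<circ> c)"
  shows "\<exists>L'. labelled P A (Suc i) L' (fst \<circ> run m E (spread \<Delta>) c)"
proof -
  define s where "s = fst \<circ> c"
  define s' where "s' = fst \<circ> run m E (spread \<Delta>) c"
  let ?f = "\<lambda>s t e. if label s = 0 \<and> t \<noteq> 0 then s\<lparr>label := t, chosen := chosen s \<union> e\<rparr> else s"
  note s = labelledD[OF L, folded s_def]
  have fst_c: "fst (c v) = s v" for v by (simp add: s_def)
  have A_le: "a \<le> m" if "a \<in> A" for a
    using that A cluster_le by (auto simp: clusters_def)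
  have L_le: "label (fst (c v)) \<le> m" for v
    using s(6)[of "\<kappa> v"] A_le by (cases "L (\<kappa> v) = 0") (simp_all add: fst_c s(3))
  have cl: "cluster (fst (c v)) = \<kappa> v" for v by (simp add: fst_c s(1))
  obtain T e where "gathered E \<kappa> (\<lambda>v. label (fst (c v))) (\<lambda>v. {}) T e"
    and run: "\<And>v. fst (run m E (spread \<Delta>) c v) = ?f (fst (c v)) (T v) (e v)"
    by (rule gather_step[of c label "\<lambda>_. {}" ?f, OF cl L_le, folded spread_def]) (rule that)
  then have G: "gathered E \<kappa> (\<lambda>v. L (\<kappa> v)) (\<lambda>v. {}) T e"
    by (simp only: fst_c s(3))
  define L' where "L' a = (if L a = 0 \<and> a \<in> range \<kappa> then T (inv \<kappa> a) else L a)" for a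
  have T_inv: "T (inv \<kappa> (\<kappa> v)) = T v" for v
    by (rule gathered_cong[OF G]) (simp add: f_inv_into_f)
  have L': "L' (\<kappa> v) = (if L (\<kappa> v) = 0 then T v else L (\<kappa> v))" for v
    by (simp add: L'_def T_inv)
  have L'_old: "L' a = L a" if "L a \<noteq> 0" for a using that by (simp add: L'_def)
  have s': "cluster (s' v) = \<kappa> v" "pending (s' v) = P v" "label (s' v) = L' (\<kappa> v)"
    "chosen (s' v) = (if L (\<kappa> v) = 0 \<and> T v \<noteq> 0 then chosen (s v) \<union> e v else chosen (s v))" for v
    using s(1-3)[of v] by (simp_all add: s'_def run fst_c L')
  let ?N = "linked (\<lambda>v. chosen (s v)) (\<lambda>v. L (\<kappa> v))"
  let ?N' = "linked (\<lambda>v. chosen (s' v)) (\<lambda>v. L' (\<kappa> v))"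
  have chosen_mono: "chosen (s v) \<subseteq> chosen (s' v)" for v by (simp add: s'(4))
  have link_mono: "link (\<lambda>v. chosen (s v)) a b \<Longrightarrow> link (\<lambda>v. chosen (s' v)) a b" for a b
    using chosen_mono unfolding link_def by blast
  \<comment> \<open>A nonzero label never changes, so routes established earlier stay inside one
    label class.\<close>
  have linked_mono: "?N' a b" if "?N a b" for a b
  proof -
    have "L (\<kappa> a) \<noteq> 0" "L (\<kappa> b) \<noteq> 0" "L (\<kappa> a) = L (\<kappa> b)"
      using that by (simp_all add: linked_def)
    then show ?thesis using that link_mono by (simp add: linked_def L'_old)
  qed
  have T_label: "T v \<in> A" if nz: "T v \<noteq> 0" for v
  proof -
    obtain u where "L (\<kappa> u) = T v"
      using gathered_witness[OF G nz] by (elim exE conjE)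
    then show ?thesis using s(6)[of "\<kappa> u"] nz by simp
  qed
  have "labelled P A (Suc i) L' s'"
    unfolding labelled_def
  proof (intro conjI allI impI)
    fix v show "\<Phi> v \<subseteq> chosen (s' v)" using s(4) chosen_mono by blast
  next
    fix v u assume u: "u \<in> chosen (s' v)"
    have "{v, u} \<in> E \<and> (u \<in> \<Phi> v \<or> \<kappa> v \<noteq> 0)"
    proof (cases "u \<in> chosen (s v)")
      case True
      then show ?thesis by (rule s(5))
    next
      case False
      then have "u \<in> e v" using u by (simp add: s'(4) split: if_splits)
      from gathered_edge[OF G this] gathered_live[OF G, of v] show ?thesis by simp
    qed
    then show "{v, u} \<in> E" "u \<in> \<Phi> v \<or> \<kappa> v \<noteq> 0" by simp_all
  next
    fix a assume a: "L' a \<noteq> 0"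
    have "L' a \<in> A \<and> a \<noteq> 0"
    proof (cases "L a = 0")
      case True
      then obtain v where v: "a = \<kappa> v" using a by (auto simp: L'_def split: if_splits)
      then have "T v \<noteq> 0" using a True L'[of v] by simp
      with T_label[of v] gathered_live[OF G, of v] show ?thesis using L'[of v] v True by simp
    next
      case False
      then show ?thesis using s(6)[of a] by (simp add: L'_old)
    qed
    then show "L' a \<in> A" "a \<noteq> 0" by simp_all
  next
    fix a r assume r: "r \<in> A" "near adj (Suc i) a r"
    show "L' a \<noteq> 0"
    proof (cases "L a = 0")
      case True
      then have "\<not> near adj i a r" using s(7)[OF r(1)] by blast
      then obtain b where b: "adj a b" "near adj i b r" using r(2) by auto
      have "L b \<noteq> 0" using b(2) by (rule s(7)[OF r(1)])
      moreover obtain v u where vu: "\<kappa> v = a" "\<kappa> u = b" "{v, u} \<in> E" "a \<noteq> 0"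
        using b(1) by (rule adjE)
      moreover have "L (\<kappa> u) \<le> T v"
        by (rule gathered_max[OF G _ vu(3)]) (use vu in simp_all)
      ultimately show ?thesis using L'[of v] True by simp
    next
      case False
      then show ?thesis by (simp add: L'_old)
    qed
  next
    fix v w assume v: "L' (\<kappa> v) \<noteq> 0" and w: "\<kappa> w = L' (\<kappa> v)"
    show "near ?N' (Suc i * (D + 1) + D) v w"
    proof (cases "L (\<kappa> v) = 0")
      case True
      then have Tv: "T v \<noteq> 0" "L' (\<kappa> v) = T v" using v L'[of v] by simp_all
      obtain x y where xy: "\<kappa> x = \<kappa> v" "T x = T v" "y \<in> e x" "L (\<kappa> y) = T v"
        using gathered_new_edge[OF G Tv(1)] by (elim exE conjE)
      have "near (\<lambda>a b. linked \<Phi> \<kappa> a b \<and> \<kappa> a = \<kappa> v) D v x"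
        by (intro near_linked_restrict diam gathered_live[OF G Tv(1)]) (simp add: xy(1))
      then have "near ?N' D v x"
      proof (rule near_mono[OF _ order_refl])
        fix a b assume ab: "linked \<Phi> \<kappa> a b \<and> \<kappa> a = \<kappa> v"
        then have "link (\<lambda>v. chosen (s' v)) a b"
          using s(4) chosen_mono unfolding linked_def link_def by blast
        moreover have "\<kappa> a = \<kappa> v" "\<kappa> b = \<kappa> v" using ab by (simp_all add: linked_def)
        ultimately show "?N' a b" using v by (simp add: linked_def)
      qed
      moreover have "near ?N' (Suc 0) x y"
      proof (rule near_edge)
        have "y \<in> chosen (s' x)" using xy True Tv by (simp add: s'(4))
        moreover have "L' (\<kappa> x) = T v" "L' (\<kappa> y) = T v"
          using xy Tv(2) L'_old[of "\<kappa> y"] Tv(1) by simp_all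
        ultimately show "?N' x y" using Tv(1) by (simp add: linked_def link_def)
      qed
      moreover have "near ?N' (i * (D + 1) + D) y w"
        by (rule near_mono[OF s(8) order_refl linked_mono]) (use xy Tv w in simp_all)
      ultimately have "near ?N' (D + (Suc 0 + (i * (D + 1) + D))) v w"
        by (intro near_trans[of ?N' D v x] near_trans[of ?N' "Suc 0" x y])
      then show ?thesis by (simp add: algebra_simps)
    next
      case False
      have "near ?N (i * (D + 1) + D) v w"
        by (rule s(8)[OF False]) (use w False in \<open>simp add: L'_old\<close>)
      then show ?thesis by (rule near_mono[OF _ _ linked_mono]) simp_all
    qed
  next
    fix a :: nat assume a: "a \<noteq> 0"
    show "(\<Sum>v | \<kappa> v = a. card (chosen (s' v))) \<le>
      (\<Sum>v | \<kappa> v = a. card (\<Phi> v)) + (if L' a = 0 then 0 else 1)"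
    proof (cases "\<exists>v. \<kappa> v = a \<and> L a = 0 \<and> T v \<noteq> 0")
      case True
      then obtain v where v: "\<kappa> v = a" "L a = 0" "T v \<noteq> 0" by (elim exE conjE)
      have "(\<Sum>w | \<kappa> w = a. card (chosen (s' w)))
        \<le> (\<Sum>w | \<kappa> w = a. card (chosen (s w)) + card (e w))"
        by (intro sum_mono) (simp add: s'(4) card_Un_le)
      also have "\<dots> \<le> (\<Sum>v | \<kappa> v = a. card (\<Phi> v)) + 1"
        using gathered_sum[OF G v(3)] finite_cluster[OF a] s(9)[OF a] v by (simp add: sum.distrib)
      also have "L' a \<noteq> 0" using L'[of v] v by simp
      then have "(\<Sum>v | \<kappa> v = a. card (\<Phi> v)) + 1 = (\<Sum>v | \<kappa> v = a. card (\<Phi> v)) + (if L' a = 0 then 0 else 1)"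
        by simp
      finally show ?thesis .
    next
      case False
      have "(\<Sum>w | \<kappa> w = a. card (chosen (s' w))) = (\<Sum>w | \<kappa> w = a. card (chosen (s w)))"
      proof (rule sum.cong[OF refl])
        fix w assume "w \<in> {w. \<kappa> w = a}"
        then have "\<kappa> w = a" by simp
        with False have "\<not> (L (\<kappa> w) = 0 \<and> T w \<noteq> 0)" by simp
        then show "card (chosen (s' w)) = card (chosen (s w))" by (simp only: s'(4) if_False)
      qed
      also have "\<dots> \<le> (\<Sum>v | \<kappa> v = a. card (\<Phi> v)) + (if L a = 0 then 0 else 1)"
        by (rule s(9)[OF a])
      also have "\<dots> \<le> (\<Sum>v | \<kappa> v = a. card (\<Phi> v)) + (if L' a = 0 then 0 else 1)"
        by (simp add: L'_old)
      finally show ?thesis .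
    qed
  qed (simp_all add: s'(1-3))
  then show ?thesis unfolding s'_def by (rule exI[of _ L'])
qed

section \<open>Counting clusters and edges over one phase\<close>

lemma card_ruling:
  assumes A: "A \<subseteq> clusters" "\<And>a. a \<in> A \<Longrightarrow> d \<le> card {b. adj a b}"
    and sep: "\<And>a b. a \<in> A \<Longrightarrow> b \<in> A \<Longrightarrow> near adj 2 a b \<Longrightarrow> a = b"
  shows "card A * (d + 1) \<le> card clusters"
proof -
  let ?B = "\<lambda>a. insert a {b. adj a b}"
  have "finite A" using A(1) finite_clusters finite_subset by blast
  have "card A * (d + 1) = (\<Sum>a\<in>A. d + 1)" by simp
  also have "\<dots> \<le> (\<Sum>a\<in>A. card (?B a))"
  proof (rule sum_mono)
    fix a assume "a \<in> A"
    have "a \<notin> {b. adj a b}" by (simp add: adj_def)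
    then show "d + 1 \<le> card (?B a)" using A(2)[OF \<open>a \<in> A\<close>] finite_adj by simp
  qed
  \<comment> \<open>Distance at least 3 makes the balls of radius 1 disjoint: a common element would
    put two members of \<open>A\<close> within distance 2.\<close>
  also have "\<dots> = card (\<Union>a\<in>A. ?B a)"
  proof (rule card_UN_disjoint[symmetric])
    show "\<forall>a\<in>A. \<forall>b\<in>A. a \<noteq> b \<longrightarrow> ?B a \<inter> ?B b = {}"
    proof (intro ballI impI)
      fix a b assume ab: "a \<in> A" "b \<in> A" "a \<noteq> b"
      have "\<not> near adj 2 a b" using sep ab by blast
      then show "?B a \<inter> ?B b = {}"
        unfolding near_2 using adj_sym by blast
    qed
  qed (use \<open>finite A\<close> finite_adj in auto)
  also have "\<dots> \<le> card clusters"
    using A(1) adj_clusters by (intro card_mono finite_clusters) blast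
  finally show ?thesis .
qed

text \<open>This turns an account kept per cluster into a total. The vertices of retired clusters
  form the fibre over 0 and pay nothing.\<close>

lemma sum_clusters_le:
  assumes "\<And>v. \<kappa> v = 0 \<Longrightarrow> f v \<le> g v"
    and "\<And>a. a \<in> clusters \<Longrightarrow> (\<Sum>v | \<kappa> v = a. f v) \<le> (\<Sum>v | \<kappa> v = a. g v) + d"
  shows "(\<Sum>v\<in>V. f v) \<le> (\<Sum>v\<in>V. g v) + card clusters * (d :: nat)"
proof -
  have "(\<Sum>v\<in>V. f v) = (\<Sum>a\<in>\<kappa> ` V. \<Sum>v | v \<in> V \<and> \<kappa> v = a. f v)"
    by (rule sum.image_gen[OF finite_V])
  also have "\<dots> \<le> (\<Sum>a\<in>\<kappa> ` V. (\<Sum>v | v \<in> V \<and> \<kappa> v = a. g v) + (if a = 0 then 0 else d))"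
  proof (rule sum_mono)
    fix a assume a: "a \<in> \<kappa> ` V"
    show "(\<Sum>v | v \<in> V \<and> \<kappa> v = a. f v) \<le> (\<Sum>v | v \<in> V \<and> \<kappa> v = a. g v) + (if a = 0 then 0 else d)"
    proof (cases "a = 0")
      case True
      have "(\<Sum>v | v \<in> V \<and> \<kappa> v = 0. f v) \<le> (\<Sum>v | v \<in> V \<and> \<kappa> v = 0. g v)"
        by (rule sum_mono) (simp add: assms(1))
      with True show ?thesis by simp
    next
      case False
      then have "{v. v \<in> V \<and> \<kappa> v = a} = {v. \<kappa> v = a}" using cluster_range by auto
      moreover have "a \<in> clusters" using a False by (auto simp: clusters_def)
      ultimately show ?thesis using assms(2) False by simp
    qed
  qed
  also have "\<dots> = (\<Sum>v\<in>V. g v) + (\<Sum>a\<in>\<kappa> ` V. if a = 0 then 0 else d)"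
    using sum.image_gen[OF finite_V, of g \<kappa>] by (simp add: sum.distrib)
  also have "(\<Sum>a\<in>\<kappa> ` V. if a = 0 then 0 else d) = (\<Sum>a\<in>\<kappa> ` V - {0}. d)"
    using finite_V by (intro sum.mono_neutral_cong_right) auto
  also have "\<dots> \<le> card clusters * d"
    using finite_clusters by (auto simp: clusters_def intro!: mult_right_mono card_mono)
  finally show ?thesis by simp
qed

text \<open>Selected clusters absorb everything within distance 2k, which includes every cluster of
  high degree, so only clusters of low degree retire. Routing through the centre gives the new
  diameter, disjoint neighborhoods give the new number of clusters, and each old cluster pays at
  most \<open>d\<close> edges.\<close>

lemma run_phase:
  assumes start: "\<And>v. cluster (fst (c v)) = \<kappa> v" "\<And>v. chosen (fst (c v)) = \<Phi> v"
      "\<And>v. seen (fst (c v)) = {}" "\<And>v. pending (fst (c v)) = {}"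
    and N: "card clusters \<le> N" and M: "(\<Sum>v\<in>V. card (\<Phi> v)) \<le> M"
    and stretch: "\<And>u v. {u, v} \<in> E \<Longrightarrow> \<kappa> u = 0 \<or> \<kappa> v = 0 \<Longrightarrow> near (link \<Phi>) (2 * D + 1) u v"
    and "1 \<le> d" "0 < \<beta>" "m < \<beta> ^ k"
  shows "invariant ((4 * k + 2) * (D + 1)) (N div (d + 1)) (M + N * d)
    (fst \<circ> run m E (phase \<Delta> \<beta> k d) c)"
proof -
  define c1 where "c1 = run m E (loop d (\<lambda>_. explore \<Delta>)) c"
  define c2 where "c2 = run m E (update \<Delta> (\<lambda>s. s\<lparr>alive := d \<le> card (seen s)\<rparr>)) c1"
  define c3 where "c3 = run m E (loop k (\<lambda>j. loop \<beta> (kill_round \<Delta> \<beta> j))) c2"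
  define c4 where "c4 = run m E (update \<Delta> (\<lambda>s. s\<lparr>label := if alive s then cluster s else 0\<rparr>)) c3"
  define c5 where "c5 = run m E (loop (2 * k) (\<lambda>_. spread \<Delta>)) c4"
  define c6 where "c6 = run m E (finish \<Delta>) c5"
  have run: "run m E (phase \<Delta> \<beta> k d) c = c6"
    by (simp only: phase_def run_append c1_def c2_def c3_def c4_def c5_def c6_def)
  have "\<exists>S. explored d S (fst \<circ> c1)"
    unfolding c1_def
  proof (rule run_loop[where P = "\<lambda>i s. \<exists>S. explored i S s"])
    have "explored 0 (\<lambda>_. {}) (fst \<circ> c)"
      unfolding explored_def by (simp add: start)
    then show "\<exists>S. explored 0 S (fst \<circ> c)" by (rule exI[of _ "\<lambda>_. {}"])
  next
    fix i and c :: "nat \<Rightarrow> full_state" assume "\<exists>S. explored i S (fst \<circ> c)"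
    then obtain S where "explored i S (fst \<circ> c)" by (elim exE)
    then show "\<exists>S. explored (Suc i) S (fst \<circ> run m E (explore \<Delta>) c)" by (rule run_explore)
  qed
  then obtain S where S: "explored d S (fst \<circ> c1)" by (elim exE)
  define P where "P v = pending (fst (c1 v))" for v
  note e = exploredD[OF S, unfolded comp_apply, folded P_def]
  define A0 where "A0 = {a \<in> clusters. d \<le> card (S a)}"
  have "ruled P A0 (fst \<circ> c2)"
    unfolding ruled_def
  proof (intro allI conjI)
    fix v
    have u: "fst (c2 v) = (fst (c1 v))\<lparr>alive := d \<le> card (seen (fst (c1 v)))\<rparr>"
      unfolding c2_def by (rule update_step) (rule e(1))
    show "cluster ((fst \<circ> c2) v) = \<kappa> v" "chosen ((fst \<circ> c2) v) = \<Phi> v"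
      "pending ((fst \<circ> c2) v) = P v"
      by (simp_all add: u e(1,2) P_def)
    have "d \<le> card (S (\<kappa> v)) \<longleftrightarrow> \<kappa> v \<in> A0"
    \<comment> \<open>Retired vertices have seen nothing, and \<open>1 \<le> d\<close> keeps them
      from being alive.\<close>
    proof (cases "\<kappa> v = 0")
      case True
      then have "S (\<kappa> v) = {}" using e(5)[of "\<kappa> v"] by (auto simp: adj_def)
      then show ?thesis using \<open>1 \<le> d\<close> True by (simp add: A0_def clusters_def)
    next
      case False
      then show ?thesis by (simp add: A0_def clusters_def)
    qed
    then show "alive ((fst \<circ> c2) v) \<longleftrightarrow> \<kappa> v \<in> A0" by (simp add: u e(3))
  qed
  moreover have A0: "A0 \<subseteq> clusters" by (auto simp: A0_def)
  ultimately have "ruled P (ruling (near adj 2) \<beta> k A0) (fst \<circ> c3)"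
    unfolding c3_def by (intro run_ruling)
  define A where "A = ruling (near adj 2) \<beta> k A0"
  have ruled: "ruled P A (fst \<circ> c3)" unfolding A_def by fact
  have "A \<subseteq> A0" unfolding A_def by (rule ruling_subset)
  then have A: "A \<subseteq> clusters" using A0 by blast
  have r3: "cluster (fst (c3 v)) = \<kappa> v" "chosen (fst (c3 v)) = \<Phi> v" "pending (fst (c3 v)) = P v"
    "alive (fst (c3 v)) \<longleftrightarrow> \<kappa> v \<in> A" for v
    using ruled[unfolded ruled_def, rule_format, of v] by simp_all
  define L0 where "L0 a = (if a \<in> A then a else 0)" for a
  have u4: "fst (c4 v) = (fst (c3 v))\<lparr>label := if alive (fst (c3 v)) then cluster (fst (c3 v)) else 0\<rparr>" for v
    unfolding c4_def by (rule update_step) (rule r3(1))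
  have s4: "cluster (fst (c4 v)) = \<kappa> v" "chosen (fst (c4 v)) = \<Phi> v" "pending (fst (c4 v)) = P v"
    "label (fst (c4 v)) = L0 (\<kappa> v)" for v
    by (simp_all add: u4 r3 L0_def)
  have "labelled P A 0 L0 (fst \<circ> c4)"
    unfolding labelled_def comp_apply s4
  proof (intro conjI allI impI)
    fix v u assume "u \<in> \<Phi> v"
    then show "{v, u} \<in> E" "u \<in> \<Phi> v \<or> \<kappa> v \<noteq> 0" by (simp_all add: chosen_edge)
  next
    fix a assume "L0 a \<noteq> 0"
    then show "L0 a \<in> A" "a \<noteq> 0" by (simp_all add: L0_def split: if_splits)
  next
    fix a r assume "r \<in> A" "near adj 0 a r"
    then show "L0 a \<noteq> 0" using A by (auto simp: L0_def clusters_def)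
  next
    fix v w assume L0: "L0 (\<kappa> v) \<noteq> 0" and w: "\<kappa> w = L0 (\<kappa> v)"
    have v: "\<kappa> v \<in> A" "\<kappa> v \<noteq> 0" "\<kappa> v = \<kappa> w"
      using L0 w by (simp_all add: L0_def split: if_splits)
    have "near (\<lambda>a b. linked \<Phi> \<kappa> a b \<and> \<kappa> a = \<kappa> v) D v w"
      by (intro near_linked_restrict diam v)
    then show "near (linked \<Phi> (\<lambda>v. L0 (\<kappa> v))) (0 * (D + 1) + D) v w"
    proof (rule near_mono)
      fix a b assume ab: "linked \<Phi> \<kappa> a b \<and> \<kappa> a = \<kappa> v"
      then have "\<kappa> a = \<kappa> v" "\<kappa> b = \<kappa> v" by (simp_all add: linked_def)
      then show "linked \<Phi> (\<lambda>v. L0 (\<kappa> v)) a b" using ab L0 by (simp add: linked_def)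
    qed simp
  qed simp_all
  have "\<exists>L. labelled P A (2 * k) L (fst \<circ> c5)"
    unfolding c5_def
  proof (rule run_loop[where P = "\<lambda>i s. \<exists>L. labelled P A i L s"])
    show "\<exists>L. labelled P A 0 L (fst \<circ> c4)" by (rule exI[of _ L0]) fact
  next
    fix i and c :: "nat \<Rightarrow> full_state" assume "\<exists>L. labelled P A i L (fst \<circ> c)"
    then obtain L where "labelled P A i L (fst \<circ> c)" by (elim exE)
    with A show "\<exists>L. labelled P A (Suc i) L (fst \<circ> run m E (spread \<Delta>) c)" by (rule run_spread)
  qed
  then obtain L where L: "labelled P A (2 * k) L (fst \<circ> c5)" by (elim exE)
  define F where "F v = chosen (fst (c5 v))" for v
  note l = labelledD[OF L, unfolded comp_apply, folded F_def]
  define s where "s = fst \<circ> c6"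
  define F' where "F' v = (if L (\<kappa> v) = 0 then F v \<union> P v else F v)" for v
  have s: "cluster (s v) = L (\<kappa> v)" "chosen (s v) = F' v" "seen (s v) = {}" "pending (s v) = {}" for v
  proof -
    have "s v = (fst (c5 v))\<lparr>cluster := label (fst (c5 v)), seen := {}, pending := {},
      chosen := if label (fst (c5 v)) = 0 then chosen (fst (c5 v)) \<union> pending (fst (c5 v))
        else chosen (fst (c5 v))\<rparr>"
      unfolding s_def comp_apply c6_def finish_def by (rule update_step) (rule l(1))
    then show "cluster (s v) = L (\<kappa> v)" "chosen (s v) = F' v" "seen (s v) = {}" "pending (s v) = {}"
      by (simp_all add: l(2,3) F'_def F_def)
  qed
  let ?D = "(4 * k + 2) * (D + 1)"
  have F_mono: "F v \<subseteq> F' v" for v by (simp add: F'_def)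
  have link_mono: "link F' a b" if "link \<Phi> a b" for a b
    using that l(4) F_mono unfolding link_def by blast
  have D_link: "near (link F') D u v" if "\<kappa> u \<noteq> 0" "\<kappa> u = \<kappa> v" for u v
    by (rule near_mono[OF diam[OF that] order_refl]) (simp add: linked_def link_mono)
  \<comment> \<open>A cluster with \<open>d\<close> known neighbors would be dominated within 2k and
    thus labelled. An unlabelled one has fewer, hence knows all its neighbors.\<close>
  have small: "S (\<kappa> v) = {b. adj (\<kappa> v) b} \<and> card (S (\<kappa> v)) < d" if nz: "\<kappa> v \<noteq> 0" and L0: "L (\<kappa> v) = 0" for v
  proof -
    have "\<kappa> v \<notin> A0"
    proof
      assume "\<kappa> v \<in> A0"
      then obtain b where b: "b \<in> A" "near (near adj 2) k (\<kappa> v) b"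
        using ruling_dominates[of "\<kappa> v" A0 "near adj 2" \<beta> k] unfolding A_def by blast
      have "near adj (2 * k) (\<kappa> v) b"
        using near_near[OF b(2)] by (simp add: mult.commute)
      with b(1) have "L (\<kappa> v) \<noteq> 0" by (rule l(7))
      with L0 show False by simp
    qed
    then have "card (S (\<kappa> v)) < d" using nz by (simp add: A0_def clusters_def)
    then show ?thesis using e(7)[of "\<kappa> v"] by simp
  qed
  \<comment> \<open>A retiring cluster keeps one edge per neighboring cluster, not per neighboring
    vertex. The detour therefore crosses both old clusters, each of diameter at most
    \<open>D\<close>, to reach the ends of that edge.\<close>
  have one_sided: "near (link F') (2 * D + 1) x y"
    if xy: "{x, y} \<in> E" "\<kappa> x \<noteq> 0" "\<kappa> y \<noteq> 0" "\<kappa> x \<noteq> \<kappa> y" and L0: "L (\<kappa> x) = 0" for x y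
  proof -
    have "adj (\<kappa> x) (\<kappa> y)" unfolding adj_def using xy by blast
    then have "\<kappa> y \<in> S (\<kappa> x)" using small[OF xy(2) L0] by simp
    from e(8)[OF this] obtain x' y' where x'y': "\<kappa> x' = \<kappa> x" "y' \<in> P x'" "\<kappa> y' = \<kappa> y"
      by (elim exE conjE)
    have "link F' x' y'" using x'y' L0 by (simp add: link_def F'_def)
    then have "near (link F') (Suc 0) x' y'" by (rule near_edge)
    moreover have "near (link F') D x x'" using x'y'(1) xy(2) by (intro D_link) simp_all
    moreover have "near (link F') D y' y" using x'y'(3) xy(3) by (intro D_link) simp_all
    ultimately have "near (link F') (D + (Suc 0 + D)) x y"
      by (intro near_trans[of _ D x x'] near_trans[of _ "Suc 0" x' y'])
    then show ?thesis by (simp add: mult_2)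
  qed
  have "invariant ?D (N div (d + 1)) (M + N * d) s"
    unfolding invariant_def s
  proof (intro conjI allI impI)
    fix v assume v: "L (\<kappa> v) \<noteq> 0"
    then have "L (\<kappa> v) \<in> A" "\<kappa> v \<noteq> 0" using l(6) by simp_all
    then show "v \<in> V" "L (\<kappa> v) \<le> m"
      using cluster_range[of v] A cluster_le by (auto simp: clusters_def)
  next
    fix v u assume u: "u \<in> F' v"
    then consider "u \<in> F v" | "u \<in> P v" by (auto simp: F'_def split: if_splits)
    then show "{v, u} \<in> E" using l(5)[of u v] e(4)[of u v] by cases simp_all
  next
    fix u v assume uv: "L (\<kappa> u) \<noteq> 0" "L (\<kappa> u) = L (\<kappa> v)"
    let ?R = "linked F' (\<lambda>v. L (\<kappa> v))"
    have mono: "?R a b" if "linked F (\<lambda>v. L (\<kappa> v)) a b" for a b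
      using that F_mono unfolding linked_def link_def by blast
    \<comment> \<open>The label is the ID of a selected cluster, and one of its members
      \<open>w\<close> is a common target for \<open>u\<close> and \<open>v\<close>. Two routes of
      length \<open>2 * k * (D + 1) + D\<close> fit into
      \<open>(4 * k + 2) * (D + 1)\<close>.\<close>
    have "L (\<kappa> u) \<in> range \<kappa>" using l(6)[OF uv(1)] A by (auto simp: clusters_def)
    then obtain w where w: "\<kappa> w = L (\<kappa> u)" by (metis imageE)
    have "near ?R (2 * k * (D + 1) + D) u w"
      by (rule near_mono[OF l(8) order_refl mono]) (use uv w in simp_all)
    moreover have "near ?R (2 * k * (D + 1) + D) v w"
      by (rule near_mono[OF l(8) order_refl mono]) (use uv w in simp_all)
    then have "near ?R (2 * k * (D + 1) + D) w v"
      by (rule near_sym[rotated]) (rule linked_sym)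
    ultimately have "near ?R ((2 * k * (D + 1) + D) + (2 * k * (D + 1) + D)) u v"
      by (rule near_trans)
    then show "near ?R ?D u v"
      by (rule near_mono) (simp_all add: algebra_simps)
  next
    have "range (\<lambda>v. L (\<kappa> v)) - {0} \<subseteq> A" using l(6) by auto
    moreover have fin: "finite A" using A finite_clusters finite_subset by blast
    ultimately have "card (range (\<lambda>v. L (\<kappa> v)) - {0}) \<le> card A" by (intro card_mono)
    moreover have "card A * (d + 1) \<le> card clusters"
    proof (rule card_ruling[OF A])
      fix a assume "a \<in> A"
      then have "d \<le> card (S a)" using \<open>A \<subseteq> A0\<close> by (auto simp: A0_def)
      also have "\<dots> \<le> card {b. adj a b}" by (intro card_mono finite_adj e(5))
      finally show "d \<le> card {b. adj a b}" .
    next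
      fix a b assume ab: "a \<in> A" "b \<in> A" "near adj 2 a b"
      have "a \<le> m" "b \<le> m" using ab A cluster_le by (auto simp: clusters_def)
      moreover have "near adj 2 y x" if "near adj 2 x y" for x y
        using that by (rule near_sym[rotated]) (rule adj_sym)
      ultimately show "a = b"
        using ab \<open>0 < \<beta>\<close> \<open>m < \<beta> ^ k\<close> unfolding A_def
        by (intro ruling_independent[of \<beta> "near adj 2" a k A0 b]) simp_all
    qed
    then have "card A * (d + 1) \<le> N" using N by simp
    then have "card A \<le> N div (d + 1)" by (simp add: less_eq_div_iff_mult_less_eq)
    ultimately show "card (range (\<lambda>v. L (\<kappa> v)) - {0}) \<le> N div (d + 1)" by simp
  next
    \<comment> \<open>A labelled cluster is charged at most one edge and a retiring one fewer than
      \<open>d\<close>; as \<open>1 \<le> d\<close>, the charge \<open>d\<close> covers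
      both.\<close>
    have "(\<Sum>v\<in>V. card (F' v)) \<le> (\<Sum>v\<in>V. card (\<Phi> v)) + card clusters * d"
    proof (rule sum_clusters_le)
      fix v assume v: "\<kappa> v = 0"
      have "P v = {}" using e(4)[of _ v] v by auto
      moreover have "F v \<subseteq> \<Phi> v" using l(5)[of _ v] v by auto
      ultimately have "F' v = \<Phi> v" using l(4)[of v] by (auto simp: F'_def)
      then show "card (F' v) \<le> card (\<Phi> v)" by simp
    next
      fix a assume "a \<in> clusters"
      then have a: "a \<noteq> 0" and "a \<in> range \<kappa>" by (auto simp: clusters_def)
      then obtain v where v: "\<kappa> v = a" by (metis imageE)
      show "(\<Sum>v | \<kappa> v = a. card (F' v)) \<le> (\<Sum>v | \<kappa> v = a. card (\<Phi> v)) + d"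
      proof (cases "L a = 0")
        case True
        have "(\<Sum>v | \<kappa> v = a. card (F' v)) \<le> (\<Sum>v | \<kappa> v = a. card (F v) + card (P v))"
          by (rule sum_mono) (simp add: F'_def card_Un_le)
        also have "\<dots> \<le> (\<Sum>v | \<kappa> v = a. card (\<Phi> v)) + card (S a)"
          using l(9)[OF a] e(9)[OF a] True by (simp add: sum.distrib)
        also have "card (S a) < d" using conjunct2[OF small[of v]] v a True by simp
        finally show ?thesis by simp
      next
        case False
        have "(\<Sum>v | \<kappa> v = a. card (F' v)) = (\<Sum>v | \<kappa> v = a. card (F v))"
          by (rule sum.cong[OF refl]) (simp add: F'_def False)
        then show ?thesis using l(9)[OF a] False \<open>1 \<le> d\<close> by simp
      qed
    qed
    also have "\<dots> \<le> M + N * d" using M N by (intro add_mono mult_right_mono) simp_all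
    finally show "(\<Sum>v\<in>V. card (F' v)) \<le> M + N * d" .
  next
    fix u v assume uv: "{u, v} \<in> E" "L (\<kappa> u) = 0 \<or> L (\<kappa> v) = 0"
    have "near (link F') (2 * D + 1) u v"
    proof (cases "\<kappa> u = 0 \<or> \<kappa> v = 0")
      case True
      from near_mono[OF stretch[OF uv(1) True] order_refl link_mono] show ?thesis by simp
    next
      case nz: False
      show ?thesis
      proof (cases "\<kappa> u = \<kappa> v")
        case True
        then have "near (link F') D u v" using nz by (intro D_link) simp_all
        then show ?thesis by (rule near_mono) simp_all
      next
        case False
        show ?thesis
        proof (cases "L (\<kappa> u) = 0")
          case True
          then show ?thesis using nz False uv(1) by (intro one_sided) simp_all
        next
          case L: False
          have "near (link F') (2 * D + 1) v u"
            by (rule one_sided) (use nz False L uv in \<open>simp_all add: insert_commute\<close>)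
          then show ?thesis by (rule near_sym[rotated]) (rule link_sym)
        qed
      qed
    qed
    then show "near (link F') (2 * ?D + 1) u v"
      by (rule near_mono) (simp_all add: algebra_simps)
  qed simp_all
  then show ?thesis unfolding s_def run .
qed

end

section \<open>Composing the phases\<close>

primrec cost :: "nat \<Rightarrow> nat list \<Rightarrow> nat" where
  "cost N [] = 0"
| "cost N (d # ds) = N * d + cost (N div (d + 1)) ds"

primrec remaining :: "nat \<Rightarrow> nat list \<Rightarrow> nat" where
  "remaining N [] = N"
| "remaining N (d # ds) = remaining (N div (d + 1)) ds"

context graph
begin

lemma run_phase_invariant:
  assumes I: "invariant D N M (fst \<circ> c)"
    and "D \<le> \<Delta>" "1 \<le> d" "0 < \<beta>" "m < \<beta> ^ k"
  shows "invariant ((4 * k + 2) * (D + 1)) (N div (d + 1)) (M + N * d)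
    (fst \<circ> run m E (phase \<Delta> \<beta> k d) c)"
proof -
  define \<kappa> where "\<kappa> v = cluster (fst (c v))" for v
  define \<Phi> where "\<Phi> v = chosen (fst (c v))" for v
  note h = I[unfolded invariant_def comp_apply, folded \<kappa>_def \<Phi>_def]
  note h1 = conjunct1[OF h] and h2 = conjunct1[OF conjunct2[OF h]]
    and h3 = conjunct1[OF conjunct2[OF conjunct2[OF h]]]
    and h4 = conjunct1[OF conjunct2[OF conjunct2[OF conjunct2[OF h]]]]
    and h5 = conjunct1[OF conjunct2[OF conjunct2[OF conjunct2[OF conjunct2[OF h]]]]]
    and h6 = conjunct1[OF conjunct2[OF conjunct2[OF conjunct2[OF conjunct2[OF conjunct2[OF h]]]]]]
    and h7 = conjunct2[OF conjunct2[OF conjunct2[OF conjunct2[OF conjunct2[OF conjunct2[OF h]]]]]]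
  interpret clustering E V m \<kappa> \<Phi> D \<Delta>
  proof
    show "v \<in> V \<and> \<kappa> v \<le> m" if "\<kappa> v \<noteq> 0" for v using that by (rule h1[rule_format])
    show "{v, u} \<in> E" if "u \<in> \<Phi> v" for u v using that by (rule h2[rule_format])
    show "near (linked \<Phi> \<kappa>) D u v" if "\<kappa> u \<noteq> 0" "\<kappa> u = \<kappa> v" for u v
      using that by (rule h3[rule_format])
  qed fact
  show ?thesis
  proof (rule run_phase)
    show "cluster (fst (c v)) = \<kappa> v" "chosen (fst (c v)) = \<Phi> v" for v
      by (simp_all add: \<kappa>_def \<Phi>_def)
    show "seen (fst (c v)) = {}" "pending (fst (c v)) = {}" for v
      using h4[rule_format, of v] by simp_all
    show "card clusters \<le> N" unfolding clusters_def by (rule h5)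
    show "(\<Sum>v\<in>V. card (\<Phi> v)) \<le> M" by (rule h6)
    show "near (link \<Phi>) (2 * D + 1) u v" if "{u, v} \<in> E" "\<kappa> u = 0 \<or> \<kappa> v = 0" for u v
      using that by (rule h7[rule_format])
  qed fact+
qed

text \<open>Since \<open>(4 * k + 2) * (D + 1) + 1\<close> is at most
  \<open>(4 * k + 3) * (D + 1)\<close>, each phase multiplies \<open>D + 1\<close> by at most
  \<open>4 * k + 3\<close>. The flooding time \<open>\<Delta>\<close> is fixed in advance for all
  phases and thus has to exceed every intermediate diameter.\<close>

lemma run_phases:
  assumes "invariant D N M (fst \<circ> c)" "D + 1 \<le> (4 * k + 3) ^ q" "(4 * k + 3) ^ (q + length ds) \<le> \<Delta>"
    and "\<And>d. d \<in> set ds \<Longrightarrow> 1 \<le> d" and \<beta>: "0 < \<beta>" "m < \<beta> ^ k"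
  shows "\<exists>D'. D' + 1 \<le> (4 * k + 3) ^ (q + length ds) \<and>
    invariant D' (remaining N ds) (M + cost N ds) (fst \<circ> run m E (concat (map (phase \<Delta> \<beta> k) ds)) c)"
  using assms(1-4)
proof (induction ds arbitrary: D N M c q)
  case Nil
  then show ?case by auto
next
  case (Cons d ds)
  let ?D = "(4 * k + 2) * (D + 1)"
  have "(4 * k + 3) ^ q \<le> (4 * k + 3) ^ (q + length (d # ds))"
    by (intro power_increasing) simp_all
  then have "D \<le> \<Delta>" using Cons.prems(2,3) by linarith
  then have I: "invariant ?D (N div (d + 1)) (M + N * d) (fst \<circ> run m E (phase \<Delta> \<beta> k d) c)"
    by (rule run_phase_invariant[OF Cons.prems(1) _ _ \<beta>]) (use Cons.prems(4) in simp_all)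
  have "?D + 1 \<le> (4 * k + 2) * (4 * k + 3) ^ q + 1 * (4 * k + 3) ^ q"
    using Cons.prems(2) by (intro add_mono mult_left_mono) simp_all
  then have "?D + 1 \<le> (4 * k + 3) ^ Suc q" by (simp add: algebra_simps)
  have "\<exists>D'. D' + 1 \<le> (4 * k + 3) ^ (Suc q + length ds) \<and>
    invariant D' (remaining (N div (d + 1)) ds) (M + N * d + cost (N div (d + 1)) ds)
      (fst \<circ> run m E (concat (map (phase \<Delta> \<beta> k) ds)) (run m E (phase \<Delta> \<beta> k d) c))"
    by (rule Cons.IH[OF I \<open>?D + 1 \<le> (4 * k + 3) ^ Suc q\<close>]) (use Cons.prems(3,4) in simp_all)
  moreover have "Suc q + length ds = q + length (d # ds)" by simp
  moreover have "run m E (concat (map (phase \<Delta> \<beta> k) (d # ds))) c =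
    run m E (concat (map (phase \<Delta> \<beta> k) ds)) (run m E (phase \<Delta> \<beta> k d) c)"
    by (simp add: run_append)
  ultimately show ?case by (simp only: cost.simps remaining.simps add.assoc)
qed

end

section \<open>Spanners from short detours\<close>

lemma near_walk:
  assumes "near R r u v" "u \<in> V" "\<And>a b. R a b \<Longrightarrow> b \<in> V \<and> {a, b} \<in> H"
  shows "\<exists>p\<in>walks V H u v. length p \<le> Suc r"
  using assms(1,2)
proof (induction r arbitrary: u)
  case 0
  then have "[u] \<in> walks V H u v" by (simp add: walks_def)
  then show ?case by force
next
  case (Suc r)
  from Suc.prems(1) consider "near R r u v" | w where "R u w" "near R r w v" by auto
  then show ?case
  proof cases
    case 1
    from Suc.IH[OF this Suc.prems(2)] show ?thesis by force
  next
    case 2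
    then obtain p where "p \<in> walks V H w v" "length p \<le> Suc r" using Suc.IH assms(3) by blast
    moreover from this have "u # p \<in> walks V H u v"
      using 2(1) Suc.prems(2) assms(3) by (cases p) (auto simp: walks_def)
    ultimately show ?thesis by (intro bexI[of _ "u # p"]) simp_all
  qed
qed

lemma walk_near:
  assumes "p \<noteq> []" "successively (\<lambda>x y. {x, y} \<in> E) p" "\<And>a b. {a, b} \<in> E \<Longrightarrow> near R l a b"
  shows "near R (l * (length p - 1)) (hd p) (last p)"
  using assms(1,2)
proof (induction p rule: induct_list012)
  case (3 x y p)
  have "near R (l + l * (length (y # p) - 1)) x (last (y # p))"
    using 3 by (intro near_trans[of R l x y] assms(3)) simp_all
  then show ?case by simp
qed simp_all

text \<open>Every edge of a shortest walk is replaced by its detour. Pairs without a walk in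
  \<open>E\<close> have infinite distance on the right-hand side.\<close>

lemma is_spanner_near:
  assumes "H \<subseteq> E" "\<And>e. e \<in> E \<Longrightarrow> e \<subseteq> V" "\<And>a b. R a b \<Longrightarrow> {a, b} \<in> H"
    and near: "\<And>a b. {a, b} \<in> E \<Longrightarrow> near R l a b" and \<alpha>: "real l \<le> \<alpha>" "1 \<le> \<alpha>"
  shows "is_spanner \<alpha> V E H"
  unfolding is_spanner_def
proof (intro conjI ballI)
  fix u v assume "u \<in> V" "v \<in> V"
  show "ereal_of_enat (hop_dist V H u v) \<le> ereal \<alpha> * ereal_of_enat (hop_dist V E u v)"
  proof (cases "walks V E u v = {}")
    case True
    then have "hop_dist V E u v = \<infinity>" by (simp add: hop_dist_def top_enat_def)
    then show ?thesis using \<alpha> by simp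
  next
    case False
    then have "hop_dist V E u v \<in> (\<lambda>p. enat (length p - 1)) ` walks V E u v"
      unfolding hop_dist_def Inf_enat_def by (auto intro: LeastI)
    then obtain p where p: "p \<in> walks V E u v" "hop_dist V E u v = enat (length p - 1)" by blast
    have "near R (l * (length p - 1)) u v"
      using walk_near[OF _ _ near, of p] p(1) by (auto simp: walks_def)
    then obtain q where q: "q \<in> walks V H u v" "length q \<le> Suc (l * (length p - 1))"
      using near_walk[of R _ u v V H] \<open>u \<in> V\<close> assms(1-3) by (meson insert_subset subsetD)
    have "hop_dist V H u v \<le> enat (length q - 1)"
      unfolding hop_dist_def using q(1) by (rule INF_lower)
    also have "\<dots> \<le> enat (l * (length p - 1))" using q(2) by simp
    finally have "ereal_of_enat (hop_dist V H u v) \<le> ereal (real l * real (length p - 1))"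
      by (metis ereal_of_enat_le_iff ereal_of_enat_simps(1) of_nat_mult)
    also have "\<dots> \<le> ereal (\<alpha> * real (length p - 1))"
      using \<alpha>(1) by (simp add: mult_right_mono)
    finally show ?thesis by (simp add: p(2))
  qed
qed (use assms in auto)

section \<open>The sequence of degrees\<close>

lemma remaining_append: "remaining N (xs @ ys) = remaining (remaining N xs) ys"
  by (induction xs arbitrary: N) simp_all

lemma cost_append: "cost N (xs @ ys) = cost N xs + cost (remaining N xs) ys"
  by (induction xs arbitrary: N) simp_all

lemma div_Suc_mult_le: "(N :: nat) div (d + 1) * d \<le> N"
proof -
  have "N div (d + 1) * d \<le> N div (d + 1) * (d + 1)" by (intro mult_left_mono) simp_all
  also have "\<dots> \<le> N" by (rule div_times_less_eq_dividend)
  finally show ?thesis .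
qed

lemma remaining_replicate: "remaining N (replicate r d) * d ^ r \<le> N"
proof (induction r arbitrary: N)
  case (Suc r)
  have "remaining N (replicate (Suc r) d) * d ^ Suc r = remaining (N div (d + 1)) (replicate r d) * d ^ r * d"
    by simp
  also have "\<dots> \<le> N div (d + 1) * d" by (intro mult_right_mono Suc.IH) simp
  also have "\<dots> \<le> N" by (rule div_Suc_mult_le)
  finally show ?case .
qed simp

text \<open>After the first phase, \<open>N div (d + 1)\<close> clusters remain, so by induction the
  rest costs at most \<open>2 * N\<close>. With \<open>2 \<le> d\<close> this is no more than the
  cost \<open>N * d\<close> of the first phase.\<close>

lemma cost_replicate:
  assumes "2 \<le> d"
  shows "cost N (replicate r d) \<le> 2 * N * d"
proof (induction r arbitrary: N)
  case (Suc r)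
  have "cost N (replicate (Suc r) d) = N * d + cost (N div (d + 1)) (replicate r d)" by simp
  also have "\<dots> \<le> N * d + 2 * (N div (d + 1)) * d" by (intro add_left_mono Suc.IH)
  also have "\<dots> \<le> N * d + 2 * N"
    using div_Suc_mult_le[of N d] by (simp add: mult.assoc)
  also have "\<dots> \<le> N * d + N * d" using assms by (simp add: mult.commute[of 2])
  finally show ?case by simp
qed simp

definition level :: "nat \<Rightarrow> nat" where
  "level i = 2 ^ 2 ^ i"

definition degrees :: "nat \<Rightarrow> nat \<Rightarrow> nat list" where
  "degrees r i = concat (map (\<lambda>j. replicate r (level j)) [0..<i])"

lemma level_Suc: "level (Suc i) = level i ^ 2"
  unfolding level_def power_mult[symmetric] by (simp add: mult.commute)

lemma level_ge: "2 ^ Suc i \<le> level i"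
  unfolding level_def by (intro power_increasing) (simp_all add: Suc_leI)

lemma degrees_Suc: "degrees r (Suc i) = degrees r i @ replicate r (level i)"
  by (simp add: degrees_def)

lemma length_degrees: "length (degrees r i) = r * i"
  by (induction i) (simp_all add: degrees_Suc, simp add: degrees_def)

text \<open>Two repetitions at level \<open>i\<close> divide the number of clusters by the square of
  its degree, which is just what passing to \<open>level (Suc i)\<close>, itself that square,
  consumes. The constant 4 is the square of \<open>level 0\<close>.\<close>

lemma remaining_degrees:
  assumes "2 \<le> r"
  shows "remaining n (degrees r i) * level i ^ 2 \<le> 4 * n"
proof (induction i)
  case 0
  then show ?case by (simp add: degrees_def level_def)
next
  case (Suc i)
  let ?R = "remaining n (degrees r i)" and ?R' = "remaining n (degrees r (Suc i))"
  have "level i ^ 2 \<le> level i ^ r"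
    using assms by (intro power_increasing) (simp_all add: level_def)
  then have "?R' * level (Suc i) ^ 2 \<le> ?R' * level i ^ r * level i ^ 2"
    unfolding level_Suc power2_eq_square[of "level i ^ 2"] mult.assoc
    by (intro mult_left_mono mult_right_mono) simp_all
  also have "?R' * level i ^ r \<le> ?R"
    by (simp add: degrees_Suc remaining_append remaining_replicate)
  finally have "?R' * level (Suc i) ^ 2 \<le> ?R * level i ^ 2" by (simp add: mult_right_mono)
  also have "\<dots> \<le> 4 * n" by (rule Suc.IH)
  finally show ?case .
qed

text \<open>By the bound on the number of remaining clusters, the phases with degree \<open>d\<close> cost
  \<open>O(n / d)\<close> edges, and the degrees grow doubly exponentially.\<close>

lemma cost_degrees:
  assumes "2 \<le> r"
  shows "real (cost n (degrees r i)) \<le> 8 * real n * (1 - 1 / 2 ^ i)"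
proof (induction i)
  case 0
  then show ?case by (simp add: degrees_def)
next
  case (Suc i)
  let ?R = "remaining n (degrees r i)" and ?d = "level i"
  have d: "2 \<le> ?d" using level_ge[of i] by (auto intro: order_trans[rotated])
  have "cost ?R (replicate r ?d) * ?d \<le> 2 * ?R * ?d * ?d"
    by (intro mult_right_mono cost_replicate d) simp
  also have "\<dots> \<le> 8 * n" using remaining_degrees[OF assms, of n i] by (simp add: power2_eq_square mult.commute mult.left_commute)
  finally have "real (cost ?R (replicate r ?d)) * real ?d \<le> 8 * real n"
    by (metis of_nat_le_iff of_nat_mult of_nat_numeral)
  moreover have "real (cost ?R (replicate r ?d)) * 2 ^ Suc i \<le> real (cost ?R (replicate r ?d)) * real ?d"
    using level_ge[of i] by (intro mult_left_mono) (metis of_nat_le_iff of_nat_numeral of_nat_power, simp)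
  ultimately have "real (cost ?R (replicate r ?d)) \<le> 8 * real n / 2 ^ Suc i"
    by (simp add: field_simps)
  with Suc.IH show ?case by (simp add: degrees_Suc cost_append field_simps)
qed

text \<open>The last level alone finishes: its 2k phases divide by \<open>level i ^ (2 * k)\<close>,
  which equals \<open>level (Suc i) ^ k\<close> and hence exceeds \<open>n\<close>.\<close>

lemma remaining_degrees_0:
  assumes "n < \<beta> ^ k" "\<beta> < level (Suc i)"
  shows "remaining n (degrees (2 * k) (Suc i)) = 0"
proof (rule ccontr)
  let ?R = "remaining n (degrees (2 * k) (Suc i))"
  assume "?R \<noteq> 0"
  have "n < \<beta> ^ k" by fact
  also have "\<beta> ^ k \<le> level (Suc i) ^ k" using assms(2) by (intro power_mono) simp_all
  also have "\<dots> = level i ^ (2 * k)" by (simp add: level_Suc power_mult)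
  also have "\<dots> \<le> ?R * level i ^ (2 * k)" using \<open>?R \<noteq> 0\<close> by simp
  also have "\<dots> \<le> remaining n (degrees (2 * k) i)"
    by (simp add: degrees_Suc remaining_append remaining_replicate)
  also have "\<dots> \<le> n"
  proof -
    have "remaining N ds \<le> N" for N ds
    proof (induction ds arbitrary: N)
      case (Cons d ds)
      have "remaining (N div (d + 1)) ds \<le> N div (d + 1)" by (rule Cons.IH)
      also have "\<dots> \<le> N" by (rule div_le_dividend)
      finally show ?case by simp
    qed simp
    then show ?thesis .
  qed
  finally show False by simp
qed

text \<open>Adding 1 to the rounded root makes the k-th power strictly exceed \<open>m\<close>, so
  that every ID has \<open>k\<close> digits.\<close>

definition base :: "nat \<Rightarrow> nat \<Rightarrow> nat" where
  "base m k = nat \<lfloor>real m powr (1 / real k)\<rfloor> + 1"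

lemma less_base_power:
  assumes "1 \<le> k" "1 \<le> m"
  shows "m < base m k ^ k"
proof -
  have "real m powr (1 / real k) < real (base m k)"
    unfolding base_def by (simp add: of_nat_nat) linarith
  then have "(real m powr (1 / real k)) ^ k < real (base m k) ^ k"
    using assms by (intro power_strict_mono) simp_all
  moreover have "(real m powr (1 / real k)) ^ k = real m"
    using assms by (simp add: powr_powr flip: powr_realpow)
  ultimately show ?thesis by (metis of_nat_less_iff of_nat_power)
qed

lemma base_le:
  assumes "1 \<le> m"
  shows "real (base m k) \<le> 2 * real m powr (1 / real k)"
proof -
  have "1 \<le> real m powr (1 / real k)" using assms by (intro ge_one_powr_ge_zero) simp_all
  moreover have "real (base m k) \<le> real m powr (1 / real k) + 1"
    unfolding base_def by (simp add: of_nat_nat)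
  ultimately show ?thesis by simp
qed

lemma base_ge_2: "1 \<le> m \<Longrightarrow> 2 \<le> base m k"
  unfolding base_def using ge_one_powr_ge_zero[of "real m" "1 / real k"]
  by (simp add: le_nat_iff)

text \<open>For \<open>\<beta> \<ge> 2\<close> this is the last level whose degree does not exceed
  \<open>\<beta>\<close>.\<close>

definition levels :: "nat \<Rightarrow> nat" where
  "levels \<beta> = (LEAST i. \<beta> < level (Suc i))"

lemma less_level_levels: "\<beta> < level (Suc (levels \<beta>))"
proof -
  have "\<beta> < 2 ^ \<beta>" by (rule less_exp)
  also have "\<dots> \<le> level (Suc \<beta>)"
    unfolding level_def using less_exp[of "Suc \<beta>"] by (intro power_increasing) simp_all
  finally show ?thesis unfolding levels_def by (rule LeastI)
qed

lemma level_le: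
  assumes "2 \<le> \<beta>" "i \<le> levels \<beta>"
  shows "level i \<le> \<beta>"
proof (cases i)
  case 0
  then show ?thesis using assms by (simp add: level_def)
next
  case (Suc j)
  then have "j < levels \<beta>" using assms by simp
  then show ?thesis unfolding Suc levels_def using not_less_Least not_less by blast
qed

section \<open>The spanner algorithm\<close>

text \<open>The single round in which an endpoint learns of edges chosen at the other end. The
  content 1 stands for any valid ID; only the arrival counts.\<close>

definition announce :: "full_state instr" where
  "announce = (\<lambda>v N (s, _) w. if w \<in> chosen s then [1] else [],
     \<lambda>v N (s, r) m. (s\<lparr>chosen := chosen s \<union> {u \<in> N. m u \<noteq> []}\<rparr>, r))"

text \<open>States are defined for every natural number. Numbers outside the graph have no neighbors
  and must not form clusters, and isolated vertices share their treatment, as no edge at them needs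
  a detour.\<close>

definition start_state :: "nat \<Rightarrow> nat set \<Rightarrow> full_state" where
  "start_state v N = (\<lparr>cluster = if N = {} then 0 else v, chosen = {}, seen = {}, pending = {},
     alive = False, label = 0, mark = 0\<rparr>, \<lambda>_. 0, 0, 0)"

definition spanner_program :: "nat \<Rightarrow> nat \<Rightarrow> nat \<Rightarrow> nat list \<Rightarrow> full_state instr list" where
  "spanner_program \<Delta> \<beta> k ds = concat (map (phase \<Delta> \<beta> k) ds) @ [announce]"

lemma length_loop: "(\<And>i. length (p i) = l) \<Longrightarrow> length (loop k p) = k * l"
  by (induction k) (simp_all add: loop_def)

lemma length_phase:
  "length (phase \<Delta> \<beta> k d) = (d + 2 * k * \<beta> + 2 * k + 3) * (2 * \<Delta> + 3)"
proof -
  have "length (loop \<beta> (kill_round \<Delta> \<beta> j)) = \<beta> * (2 * (2 * \<Delta> + 3))" for j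
    by (rule length_loop) (simp add: kill_round_def length_gather)
  then have "length (loop k (\<lambda>j. loop \<beta> (kill_round \<Delta> \<beta> j))) = k * (\<beta> * (2 * (2 * \<Delta> + 3)))"
    by (rule length_loop)
  moreover have "length (loop d (\<lambda>_. explore \<Delta>)) = d * (2 * \<Delta> + 3)"
    by (rule length_loop) (simp add: explore_def length_gather)
  moreover have "length (loop (2 * k) (\<lambda>_. spread \<Delta>)) = 2 * k * (2 * \<Delta> + 3)"
    by (rule length_loop) (simp add: spread_def length_gather)
  moreover have "length (update \<Delta> f) = 2 * \<Delta> + 3" "length (finish \<Delta>) = 2 * \<Delta> + 3" for f
    by (simp_all add: finish_def update_def length_gather)
  ultimately show ?thesis by (simp add: phase_def algebra_simps)
qed

lemma length_spanner_program:
  assumes "\<And>d. d \<in> set ds \<Longrightarrow> d \<le> \<beta>" "1 \<le> \<beta>" "1 \<le> k" "1 \<le> \<Delta>"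
  shows "length (spanner_program \<Delta> \<beta> k ds) \<le> length ds * (40 * k * \<beta> * \<Delta>) + 1"
proof -
  have "length (concat (map (phase \<Delta> \<beta> k) ds)) \<le> length ds * (40 * k * \<beta> * \<Delta>)"
    using assms(1)
  proof (induction ds)
    case (Cons d ds)
    have kb: "k \<le> k * \<beta>" "\<beta> \<le> k * \<beta>" "1 \<le> k * \<beta>" using assms(2,3) by simp_all
    have "d \<le> \<beta>" using Cons.prems by simp
    \<comment> \<open>The coefficients 1, 2, 2 and 3 add up to 8, each summand being bounded through
      \<open>k * \<beta>\<close>.\<close>
    then have "d + 2 * k * \<beta> + 2 * k + 3 \<le> 8 * (k * \<beta>)" 
      using kb unfolding mult.assoc[of 2 k \<beta>] by linarith
    then have "length (phase \<Delta> \<beta> k d) \<le> 8 * (k * \<beta>) * (5 * \<Delta>)"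
      unfolding length_phase using assms(4) by (intro mult_mono) simp_all
    moreover have "length (concat (map (phase \<Delta> \<beta> k) ds)) \<le> length ds * (40 * k * \<beta> * \<Delta>)"
      using Cons by simp
    ultimately show ?case by (simp add: mult.assoc)
  qed simp
  then show ?thesis by (simp add: spanner_program_def)
qed

context graph
begin

lemma start_invariant:
  "invariant 0 (card V) 0 (fst \<circ> (\<lambda>v. start_state v (neighbors E v)))"
proof -
  define s where "s v = fst (start_state v (neighbors E v))" for v
  have cl: "cluster (s v) = (if neighbors E v = {} then 0 else v)" for v
    by (simp add: s_def start_state_def)
  have V: "v \<in> V" if "neighbors E v \<noteq> {}" for v
    using that edgeD by auto
  have pos: "cluster (s v) \<noteq> 0" if "{v, u} \<in> E" for u v
  proof -
    have "u \<in> neighbors E v" using that by simp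
    then have "neighbors E v \<noteq> {}" by blast
    moreover have "v \<noteq> 0" using edgeD[OF that] ids by auto
    ultimately show ?thesis by (simp add: cl)
  qed
  have live: "neighbors E v \<noteq> {} \<and> cluster (s v) = v" if "cluster (s v) \<noteq> 0" for v
    using that by (simp add: cl split: if_splits)
  have "invariant 0 (card V) 0 s"
    unfolding invariant_def
  proof (intro conjI allI impI)
    fix v assume "cluster (s v) \<noteq> 0"
    then have v: "v \<in> V" "cluster (s v) = v" using live V by blast+
    then show "v \<in> V" "cluster (s v) \<le> m" using ids by auto
  next
    fix u v assume "cluster (s u) \<noteq> 0" "cluster (s u) = cluster (s v)"
    then have "u = v" using live[of u] live[of v] by simp
    then show "near (linked (\<lambda>v. chosen (s v)) (\<lambda>v. cluster (s v))) 0 u v" by simp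
  next
    have "range (\<lambda>v. cluster (s v)) - {0} \<subseteq> V"
    proof
      fix a assume "a \<in> range (\<lambda>v. cluster (s v)) - {0}"
      then obtain v where "cluster (s v) = a" "a \<noteq> 0" by auto
      then show "a \<in> V" using live[of v] V[of v] by simp
    qed
    then show "card (range (\<lambda>v. cluster (s v)) - {0}) \<le> card V" by (intro card_mono finite_V)
  next
    fix u v assume uv: "{u, v} \<in> E" "cluster (s u) = 0 \<or> cluster (s v) = 0"
    have "{v, u} \<in> E" using uv(1) by (simp add: insert_commute)
    with uv pos show "near (link (\<lambda>v. chosen (s v))) (2 * 0 + 1) u v" by blast
  qed (simp_all add: s_def start_state_def)
  then show ?thesis by (simp add: s_def[abs_def] comp_def)
qed

lemma run_announce:
  assumes "\<And>v u. u \<in> F v \<Longrightarrow> {v, u} \<in> E" "\<And>v. chosen (fst (c v)) = F v" "1 \<le> m"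
  shows "chosen (fst (run m E [announce] c v)) = {u. link F v u}"
proof -
  obtain s r where c: "c = (\<lambda>v. (s v, r v))"
  proof
    show "c = (\<lambda>v. (fst (c v), snd (c v)))" by simp
  qed
  have F: "chosen (s v) = F v" for v using assms(2)[of v] by (simp add: c)
  have "chosen (fst (run m E [announce] c v)) = F v \<union> {u. {v, u} \<in> E \<and> v \<in> F u}"
    using assms(3) by (auto simp: run_Cons exec_def announce_def c F clip_def)
  also have "\<dots> = {u. link F v u}"
    using assms(1) edge_sym by (auto simp: link_def)
  finally show ?thesis .
qed

text \<open>Once no cluster remains, both ends of every edge are retired, so the last clause of the
  invariant provides a detour for each edge. Forming unordered pairs only decreases the count of
  choices.\<close>

lemma spanner_program_correct:
  assumes "(4 * k + 3) ^ length ds \<le> \<Delta>" "\<And>d. d \<in> set ds \<Longrightarrow> 1 \<le> d" "0 < \<beta>" "m < \<beta> ^ k" "1 \<le> m"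
    and rem: "remaining (card V) ds = 0" and \<alpha>: "2 * real \<Delta> \<le> \<alpha>"
  shows "\<exists>H. (\<forall>v. chosen (fst (run m E (spanner_program \<Delta> \<beta> k ds)
      (\<lambda>v. start_state v (neighbors E v)) v)) = neighbors H v) \<and>
    is_spanner \<alpha> V E H \<and> card H \<le> cost (card V) ds"
proof -
  define c where "c = run m E (concat (map (phase \<Delta> \<beta> k) ds)) (\<lambda>v. start_state v (neighbors E v))"
  obtain D where D: "D + 1 \<le> (4 * k + 3) ^ (0 + length ds)"
    and I: "invariant D (remaining (card V) ds) (0 + cost (card V) ds) (fst \<circ> c)"
    unfolding c_def using run_phases[OF start_invariant _ _ _ assms(3,4), where q = 0 and ds = ds and \<Delta> = \<Delta>] assms(1,2)
    by auto
  define F where "F v = chosen (fst (c v))" for v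
  define \<kappa> where "\<kappa> v = cluster (fst (c v))" for v
  note h = I[unfolded invariant_def comp_apply rem, folded F_def \<kappa>_def]
  have live: "v \<in> V \<and> \<kappa> v \<le> m" if "\<kappa> v \<noteq> 0" for v using h that by blast
  have F: "{v, u} \<in> E" if "u \<in> F v" for u v using h that by blast
  have "card (range \<kappa> - {0}) = 0" using h by simp
  moreover have "finite (range \<kappa> - {0})"
    by (rule finite_subset[of _ "{..m}"]) (use live in auto)
  ultimately have "\<kappa> v = 0" for v by auto
  then have near: "near (link F) (2 * D + 1) u v" if "{u, v} \<in> E" for u v
    using h that by blast
  have sum: "(\<Sum>v\<in>V. card (F v)) \<le> cost (card V) ds" using h by simp
  define H where "H = (\<lambda>(v, u). {v, u}) ` (SIGMA v:V. F v)"
  have H: "{v, u} \<in> H \<longleftrightarrow> link F v u" for u v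
  proof
    assume "{v, u} \<in> H"
    then obtain a b where "{v, u} = {a, b}" "b \<in> F a" by (auto simp: H_def)
    then show "link F v u" by (auto simp: doubleton_eq_iff link_def)
  next
    have "{a, b} \<in> H" if "b \<in> F a" for a b
      unfolding H_def using F[OF that] edgeD that by force
    then show "link F v u \<Longrightarrow> {v, u} \<in> H" unfolding link_def by (metis insert_commute)
  qed
  have fin: "finite (F v)" for v
    by (rule finite_subset[OF _ finite_V]) (use F edgeD in blast)
  have "chosen (fst (run m E (spanner_program \<Delta> \<beta> k ds)
      (\<lambda>v. start_state v (neighbors E v)) v)) = neighbors H v" for v
  proof -
    have "chosen (fst (run m E [announce] c v)) = {u. link F v u}"
      by (rule run_announce[OF _ _ \<open>1 \<le> m\<close>]) (use F in \<open>simp_all add: F_def\<close>)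
    then show ?thesis
      unfolding spanner_program_def run_append c_def[symmetric] by (simp add: neighbors_def H)
  qed
  moreover have "is_spanner \<alpha> V E H"
  proof (rule is_spanner_near[OF _ _ _ near])
    show "H \<subseteq> E" using F by (auto simp: H_def)
    show "e \<subseteq> V" if "e \<in> E" for e using simple that by (auto simp: simple_graph_def)
    show "{a, b} \<in> H" if "link F a b" for a b using that H by simp
    have "2 * D + 2 \<le> 2 * \<Delta>" using D assms(1) by simp
    then have "real (2 * D + 2) \<le> 2 * real \<Delta>" by (metis of_nat_le_iff of_nat_mult of_nat_numeral)
    with \<alpha> show "real (2 * D + 1) \<le> \<alpha>" "1 \<le> \<alpha>" by simp_all
  qed
  moreover have "card H \<le> cost (card V) ds"
  proof -
    have "card H \<le> card (SIGMA v:V. F v)"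
      unfolding H_def by (intro card_image_le finite_SigmaI finite_V fin)
    also have "\<dots> = (\<Sum>v\<in>V. card (F v))" using finite_V fin by simp
    finally show ?thesis using sum by simp
  qed
  ultimately show ?thesis by blast
qed

end

section \<open>Polylogarithmic bounds and the choice of parameters\<close>

lemma log_power_le_powr:
  fixes a k :: nat
  assumes "1 \<le> k" "1 \<le> a"
  shows "\<exists>c>0. \<forall>n\<ge>2. log 2 (real n) ^ a \<le> c * real n powr (1 / real k)"
proof -
  \<comment> \<open>The exponent is chosen so that raising the linear bound on the logarithm to the
    power \<open>a\<close> yields exactly \<open>1 / real k\<close>.\<close>
  let ?e = "1 / (real a * real k)"
  define c where "c = (1 / (ln 2 * ?e)) ^ a"
  have e: "0 < ?e" using assms by simp
  have "log 2 (real n) ^ a \<le> c * real n powr (1 / real k)" if "2 \<le> n" for n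
  proof -
    have "ln (real n) \<le> real n powr ?e / ?e" using that e by (intro ln_powr_bound) simp_all
    then have "log 2 (real n) \<le> 1 / (ln 2 * ?e) * real n powr ?e"
      unfolding log_def using e by (simp add: divide_right_mono field_simps)
    then have "log 2 (real n) ^ a \<le> (1 / (ln 2 * ?e) * real n powr ?e) ^ a"
      using that by (intro power_mono) (simp_all add: zero_le_log_cancel_iff)
    also have "\<dots> = c * (real n powr ?e) ^ a" by (simp only: power_mult_distrib c_def)
    also have "(real n powr ?e) ^ a = real n powr (1 / real k)"
      using that assms by (simp add: powr_powr flip: powr_realpow)
    finally show ?thesis .
  qed
  moreover have "0 < c" unfolding c_def using e by (intro zero_less_power) simp
  ultimately show ?thesis by blast
qed

text \<open>With the phases of all degrees \<open>2 ^ 2 ^ i \<le> \<beta>\<close>, each repeated \<open>2 * k\<close> times, the bound on the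
  cluster diameters is polylogarithmic since there are only \<open>O(log log n)\<close> levels.\<close>

definition diameter_bound :: "nat \<Rightarrow> nat \<Rightarrow> nat" where
  "diameter_bound k \<beta> = (4 * k + 3) ^ (2 * k * Suc (levels \<beta>))"

text \<open>With \<open>I\<close> the last level, \<open>2 ^ I\<close> is the logarithm of its
  degree and thus O(log n). Bounding \<open>4 * k + 3\<close> by a power of 2 turns the exponential
  in \<open>I\<close> into a fixed power of \<open>2 ^ Suc I\<close>.\<close>

lemma diameter_bound_le:
  assumes "1 \<le> K" "1 \<le> k"
  shows "\<exists>c\<ge>1. \<exists>b\<ge>1. \<forall>n\<ge>2. real (diameter_bound k (base (K * n) k)) \<le> (c * log 2 (real n)) ^ b"
proof -
  define a where "a = 4 * k + 3"
  define b where "b = a * (2 * k)"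
  \<comment> \<open>The factor 2 accounts for \<open>Suc I\<close>. The additive term
    \<open>log 2 (2 * real K)\<close> becomes a factor because \<open>log 2 (real n)\<close> is at
    least 1.\<close>
  define c where "c = 2 * (1 + log 2 (2 * real K))"
  have c: "1 \<le> c" using assms unfolding c_def by (simp add: zero_le_log_cancel_iff)
  have "real (diameter_bound k (base (K * n) k)) \<le> (c * log 2 (real n)) ^ b" if n: "2 \<le> n" for n
  proof -
    define \<beta> where "\<beta> = base (K * n) k"
    define I where "I = levels \<beta>"
    have Kn: "1 \<le> K * n" using assms n by simp
    have "level I \<le> \<beta>" unfolding I_def \<beta>_def by (rule level_le[OF base_ge_2[OF Kn] order_refl])
    then have "real (level I) \<le> real \<beta>" by simp
    also have "\<dots> \<le> 2 * real (K * n) powr (1 / real k)" unfolding \<beta>_def by (rule base_le[OF Kn])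
    also have "\<dots> \<le> 2 * real (K * n) powr 1"
    proof (intro mult_left_mono powr_mono)
      show "1 \<le> real (K * n)" using Kn by (metis of_nat_1 of_nat_le_iff)
    qed (use assms in simp_all)
    finally have "real (level I) \<le> (2 * real K) * real n" using Kn by simp
    then have "log 2 (real (level I)) \<le> log 2 ((2 * real K) * real n)"
      by (subst log_le_cancel_iff) (use assms n in \<open>simp_all add: level_def\<close>)
    also have "\<dots> = log 2 (2 * real K) + log 2 (real n)" using assms n by (simp add: log_mult)
    also have "\<dots> \<le> log 2 (2 * real K) * log 2 (real n) + log 2 (real n)"
      using assms n by (intro add_right_mono mult_left_le[THEN order_trans] order_refl)
        (simp_all add: mult_le_cancel_left1 zero_le_log_cancel_iff)
    finally have "2 ^ Suc I \<le> c * log 2 (real n)"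
      by (simp add: level_def c_def log_nat_power algebra_simps)
    then have "(2 ^ Suc I) ^ b \<le> (c * log 2 (real n)) ^ b" by (intro power_mono) simp_all
    moreover have "real (diameter_bound k \<beta>) \<le> (2 ^ Suc I) ^ b"
    proof -
      have "diameter_bound k \<beta> \<le> (2 ^ a) ^ (2 * k * Suc I)"
        unfolding diameter_bound_def a_def[symmetric] I_def[symmetric]
        by (intro power_mono less_imp_le less_exp) (simp add: a_def)
      also have "\<dots> = (2 ^ Suc I) ^ b"
        unfolding b_def power_mult[symmetric] by (simp add: ac_simps)
      finally have "real (diameter_bound k \<beta>) \<le> real ((2 ^ Suc I) ^ b)" by (simp only: of_nat_le_iff)
      then show ?thesis by simp
    qed
    ultimately show ?thesis unfolding \<beta>_def by linarith
  qed
  moreover have "1 \<le> b" using assms by (simp add: b_def a_def)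
  ultimately show ?thesis using c by blast
qed

(* K is the constant in the ID range {1..O(n)}, B the number of IDs per message. *)
theorem mainTheorem4:
  fixes K :: nat
  assumes "K \<ge> 1"
  shows "\<exists>B :: nat. \<forall>\<rho> :: real. \<rho> > 0 \<longrightarrow>
    (\<exists>(C :: real) > 0. \<exists>(b :: real) > 0. \<exists>A :: nat algorithm.
      \<forall>(n :: nat) (V :: nat set) (E :: nat set set).
        n \<ge> 4 \<and> simple_graph V E \<and> connected_graph V E \<and> card V = n \<and> V \<subseteq> {1..K * n} \<longrightarrow>
          respects_bandwidth K B A V E \<and>
          (\<exists>t H. real t \<le> C * real n powr \<rho> \<and>
            constructs_within A V E t H \<and>
            is_spanner (C * (log 2 (real n)) powr b) V E H \<and>
            real (card H) \<le> C * real n))"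
proof (rule exI[of _ 2], intro allI impI)
  fix \<rho> :: real assume "\<rho> > 0"
  \<comment> \<open>The running time has two factors n^(1/k), one from the base and one bounding the
    polylogarithmic square of \<open>\<Delta>\<close>, so 2/k has to be at most
    \<open>\<rho>\<close>.\<close>
  define k where "k = nat \<lceil>2 / \<rho>\<rceil>"
  have "2 / \<rho> \<le> real k" unfolding k_def by linarith
  moreover have "0 < 2 / \<rho>" using \<open>\<rho> > 0\<close> by simp
  ultimately have "0 < real k" "2 \<le> real k * \<rho>"
    using \<open>\<rho> > 0\<close> by (linarith, simp add: pos_divide_le_eq)
  then have k: "1 \<le> k" "2 / real k \<le> \<rho>"
    by (simp_all add: pos_divide_le_eq mult.commute)
  obtain c b where cb: "1 \<le> c" "1 \<le> b"
    "\<And>n. 2 \<le> n \<Longrightarrow> real (diameter_bound k (base (K * n) k)) \<le> (c * log 2 (real n)) ^ b"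
    using diameter_bound_le[OF assms k(1)] by blast
  obtain c' where c': "0 < c'" "\<And>n. 2 \<le> n \<Longrightarrow> log 2 (real n) ^ (b * 2) \<le> c' * real n powr (1 / real k)"
    using log_power_le_powr[OF k(1), of "b * 2"] cb(2) by auto
  define \<beta> where "\<beta> n = base (K * n) k" for n
  define \<Delta> where "\<Delta> n = diameter_bound k (\<beta> n)" for n
  define ds where "ds n = degrees (2 * k) (Suc (levels (\<beta> n)))" for n
  define prog where "prog n = spanner_program (\<Delta> n) (\<beta> n) k (ds n)" for n
  define C1 where "C1 = 41 * real k * (2 * real K) * c ^ (b * 2) * c'"
  \<comment> \<open>The three summands cover the stretch, the number of edges and the number of
    rounds.\<close>
  define C where "C = 2 * c ^ b + 8 + C1"
  have "0 \<le> C1" using c' cb by (simp add: C1_def)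
  have C: "0 < C" "2 * c ^ b \<le> C" "8 \<le> C" "C1 \<le> C"
    using \<open>0 \<le> C1\<close> cb(1) by (simp_all add: C_def add_pos_nonneg add_nonneg_pos)
  obtain A :: "nat algorithm" where A: "\<forall>V E. finite V \<and> (\<forall>e\<in>E. e \<subseteq> V) \<longrightarrow>
    respects_bandwidth K 2 A V E \<and>
    (\<forall>v. result A (state A V E (length (prog (card V))) v) =
      Some (chosen (fst (run (K * card V) E (prog (card V)) (\<lambda>v. start_state v (neighbors E v)) v))))"
    using compile[of K prog "\<lambda>d. chosen (fst d)" start_state] by (rule exE)
  have "respects_bandwidth K 2 A V E \<and>
      (\<exists>t H. real t \<le> C * real n powr \<rho> \<and> constructs_within A V E t H \<and>
        is_spanner (C * (log 2 (real n)) powr real b) V E H \<and> real (card H) \<le> C * real n)"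
    if n: "n \<ge> 4" and G: "simple_graph V E" "card V = n" "V \<subseteq> {1..K * n}" for n V E
  proof -
    interpret graph E V "K * n" using G by unfold_locales
    have Kn: "1 \<le> K * n" using assms n by simp
    have log: "1 \<le> log 2 (real n)" using n by (simp add: le_log_iff)
    have \<beta>: "2 \<le> \<beta> n" "K * n < \<beta> n ^ k" "real (\<beta> n) \<le> 2 * real (K * n) powr (1 / real k)"
      unfolding \<beta>_def using base_ge_2 less_base_power base_le Kn k by blast+
    have ds: "1 \<le> d" "d \<le> \<beta> n" if d: "d \<in> set (ds n)" for d
    proof -
      obtain i where "d = level i" "i \<le> levels (\<beta> n)"
        using d by (auto simp: ds_def degrees_def less_Suc_eq_le)
      then show "1 \<le> d" "d \<le> \<beta> n" using level_le[OF \<beta>(1)] by (simp_all add: level_def)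
    qed
    have \<Delta>_ds: "(4 * k + 3) ^ length (ds n) = \<Delta> n"
      by (simp only: \<Delta>_def ds_def diameter_bound_def length_degrees)
    have \<Delta>1: "1 \<le> \<Delta> n" by (simp add: \<Delta>_def diameter_bound_def)
    have \<Delta>: "real (\<Delta> n) \<le> (c * log 2 (real n)) ^ b"
      unfolding \<Delta>_def \<beta>_def using n by (intro cb(3)) simp
    have "n \<le> K * n" using assms by simp
    then have "n < \<beta> n ^ k" using \<beta>(2) by (rule le_less_trans)
    then have "remaining n (ds n) = 0"
      unfolding ds_def using less_level_levels by (rule remaining_degrees_0)
    moreover have "2 * real (\<Delta> n) \<le> C * log 2 (real n) powr real b"
    proof -
      have "2 * real (\<Delta> n) \<le> (2 * c ^ b) * log 2 (real n) ^ b" using \<Delta> by (simp add: power_mult_distrib)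
      also have "\<dots> \<le> C * log 2 (real n) ^ b" using C log by (intro mult_right_mono) simp_all
      finally show ?thesis using log by (simp add: powr_realpow)
    qed
    ultimately have "\<exists>H. (\<forall>v. chosen (fst (run (K * n) E (prog n) (\<lambda>v. start_state v (neighbors E v)) v)) =
        neighbors H v) \<and> is_spanner (C * log 2 (real n) powr real b) V E H \<and> card H \<le> cost n (ds n)"
      using spanner_program_correct[of k "ds n" "\<Delta> n" "\<beta> n", OF eq_refl[OF \<Delta>_ds] ds(1) _ \<beta>(2) Kn] \<beta>(1)
      unfolding G(2) prog_def by simp
    then obtain H where
      H: "\<forall>v. chosen (fst (run (K * n) E (prog n) (\<lambda>v. start_state v (neighbors E v)) v)) = neighbors H v"
      "is_spanner (C * log 2 (real n) powr real b) V E H" "card H \<le> cost n (ds n)"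
      by (elim exE conjE)
    have "real (card H) \<le> real (cost n (ds n))" using H(3) by simp
    also have "\<dots> \<le> 8 * real n * (1 - 1 / 2 ^ Suc (levels (\<beta> n)))"
      unfolding ds_def using k(1) by (intro cost_degrees) simp
    also have "\<dots> \<le> 8 * real n" by (simp add: mult_left_le)
    also have "\<dots> \<le> C * real n" using C by (intro mult_right_mono) simp_all
    finally have card_H: "real (card H) \<le> C * real n" .
    have "real (length (prog n)) \<le> C * real n powr \<rho>"
    proof -
      \<comment> \<open>The number of phases is bounded crudely by \<open>\<Delta> n\<close>. This
        costs a second polylogarithmic factor, whence the exponent \<open>b * 2\<close>.\<close>
      have "length (ds n) \<le> (4 * k + 3) ^ length (ds n)"
        by (intro less_imp_le power_gt_expt) simp
      then have "length (prog n) \<le> \<Delta> n * (40 * k * \<beta> n * \<Delta> n) + 1"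
        unfolding prog_def \<Delta>_ds using \<beta>(1) k(1) \<Delta>1 ds
        by (intro order_trans[OF length_spanner_program] add_right_mono mult_right_mono) simp_all
      also have "\<dots> \<le> \<Delta> n * (40 * k * \<beta> n * \<Delta> n) + k * \<beta> n * \<Delta> n ^ 2"
        using \<beta>(1) k(1) \<Delta>1 by simp
      also have "\<dots> = 41 * k * \<beta> n * \<Delta> n ^ 2" by (simp add: power2_eq_square)
      finally have "real (length (prog n)) \<le> 41 * real k * real (\<beta> n) * real (\<Delta> n) ^ 2"
        by (metis of_nat_le_iff of_nat_mult of_nat_numeral of_nat_power)
      also have "real (\<beta> n) \<le> 2 * real K * real n powr (1 / real k)"
      proof -
        have "real K powr (1 / real k) \<le> real K powr 1"
          using assms k(1) by (intro powr_mono) simp_all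
        then have "real (K * n) powr (1 / real k) \<le> real K * real n powr (1 / real k)"
          using assms by (simp add: powr_mult mult_right_mono)
        with \<beta>(3) show ?thesis by simp
      qed
      also have "real (\<Delta> n) ^ 2 \<le> c ^ (b * 2) * (c' * real n powr (1 / real k))"
      proof -
        have "real (\<Delta> n) ^ 2 \<le> ((c * log 2 (real n)) ^ b) ^ 2" using \<Delta> by (intro power_mono) simp_all
        also have "\<dots> = c ^ (b * 2) * log 2 (real n) ^ (b * 2)"
          by (simp only: power_mult power_mult_distrib)
        also have "\<dots> \<le> c ^ (b * 2) * (c' * real n powr (1 / real k))"
          using c'(2)[of n] n cb(1) by (intro mult_left_mono) simp_all
        finally show ?thesis .
      qed
      finally have "real (length (prog n)) \<le>
        41 * real k * (2 * real K * real n powr (1 / real k)) * (c ^ (b * 2) * (c' * real n powr (1 / real k)))"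
        using cb(1) c'(1) by (simp add: mult_left_mono mult_right_mono)
      also have "\<dots> = C1 * (real n powr (1 / real k) * real n powr (1 / real k))"
        unfolding C1_def by (simp only: ac_simps)
      also have "\<dots> = C1 * real n powr (2 / real k)" by (simp flip: powr_add)
      also have "\<dots> \<le> C * real n powr \<rho>"
        using C k n \<open>0 \<le> C1\<close> by (intro mult_mono powr_mono) simp_all
      finally show ?thesis .
    qed
    moreover have "finite V \<and> (\<forall>e\<in>E. e \<subseteq> V)" using G(1) by (simp add: simple_graph_def)
    note A = A[rule_format, OF this, unfolded G(2) H(1)[rule_format]]
    have "constructs_within A V E (length (prog n)) H"
      unfolding constructs_within_def using conjunct2[OF A] by blast
    ultimately show ?thesis using conjunct1[OF A] H(2) card_H by blast
  qed
  then show "\<exists>(C :: real) > 0. \<exists>(b :: real) > 0. \<exists>A :: nat algorithm.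
      \<forall>(n :: nat) (V :: nat set) (E :: nat set set).
        n \<ge> 4 \<and> simple_graph V E \<and> connected_graph V E \<and> card V = n \<and> V \<subseteq> {1..K * n} \<longrightarrow>
          respects_bandwidth K 2 A V E \<and>
          (\<exists>t H. real t \<le> C * real n powr \<rho> \<and>
            constructs_within A V E t H \<and>
            is_spanner (C * (log 2 (real n)) powr b) V E H \<and>
            real (card H) \<le> C * real n)"
    using C(1) cb(2) by (intro exI[of _ C] exI[of _ "real b"] exI[of _ A] conjI allI impI) auto
qed

end
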